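(* Let $\mathbf M$ and $\mathbf N$ be non-trivial total structures (not necessarily of the same type) and let $\widetilde{\mathbf M}$ and $\widetilde{\mathbf N}=\langle N;G^\nu,R^\nu,\mathcal T\rangle$ be total structures with topology that are alter egos of $\mathbf M$ and $\mathbf N$, respectively. Put $\mathcal A=\mathbb{ISP}(\mathbf M)$, $\mathcal X=\mathbb{IS}_c\mathbb P^+(\widetilde{\mathbf M})$, $\mathcal B=\mathbb{ISP}(\mathbf N)$, $\mathcal Y=\mathbb{IS}_c\mathbb P^+(\widetilde{\mathbf N})$. Assume that $\widetilde{\mathbf N}$ fully dualises $\mathbf N$, that $\widetilde{\mathbf N}$ is injective in $\mathcal Y$ and that $\mathbf N$ is injective in $\mathcal B$. Assume that $\mathbf M$ has a structural reduct $\mathbf M^\flat$ in $\mathcal B$ and let $\Omega\subseteq\mathcal B(\mathbf M^\flat,\mathbf N)$. Then $\widetilde{\mathbf M}$ dualises $\mathbf M$ provided at least one of the following alternatives (S), (G) holds. (S) $\Omega=\{\omega\}$ is a singleton and all of the following hold: (0) $\omega$ is continuous with respect to the topologies on $\widetilde{\mathbf M}$ and $\widetilde{\mathbf N}$; (1) $\omega\circ\mathrm{Clo}_1(\widetilde{\mathbf M})$ separates the structure $\mathbf M^\flat$; (2) (i) $\widetilde{\mathbf N}$ is purely relational, or (ii) $\widetilde{\mathbf M}$ has a structural reduct $\widetilde{\mathbf M}^\flat$ in $\mathcal Y$ with $\omega\in\mathcal Y(\widetilde{\mathbf M}^\flat,\widetilde{\mathbf N})$; (3) (i) $\widetilde{\mathbf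 M}$ entails every relation in $\max_{\mathbf M}\{\omega\}^{-1}(r)$, for each $r\in R^\nu$, and (ii) either (a) $\widetilde{\mathbf M}$ entails each binary relation on $M$ which forms a substructure of $\mathbf M^2$ that is maximal in $\ker(\omega)$, or (b) $\omega\circ\mathrm{Clo}_1(\mathbf M)$ separates the points of $M$. (G) All of the following hold: (0) $\Omega$ is finite and each $\omega\in\Omega$ is continuous with respect to the topologies on $\widetilde{\mathbf M}$ and $\widetilde{\mathbf N}$; (1) $\Omega\circ\mathrm{Clo}_1(\widetilde{\mathbf M})$ separates the structure $\mathbf M^\flat$; (2) (i) $\widetilde{\mathbf N}$ is purely relational, or (ii) $\widetilde{\mathbf M}$ has a structural reduct $\widetilde{\mathbf M}^\flat$ in $\mathcal Y$, each $\omega\in\Omega$ belongs to $\mathcal Y(\widetilde{\mathbf M}^\flat,\widetilde{\mathbf N})$, and every operation in $G^\nu$ is unary or nullary; (3) (i) $\widetilde{\mathbf M}$ entails every relation in $\max_{\mathbf M}\Omega^{-1}(r)$, for each $r\in R^\nu$, and (ii) $\widetilde{\mathbf M}$ entails every relation in $\max_{\mathbf M}\Omega^{-1}(\Delta_N)$.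
   Context: **Structures.** A total structure is $\mathbf M=\langle M;G,R\rangle$ with $M$ a non-empty set, $G$ a set of finitary operations (nullary allowed) and $R$ a set of finitary non-empty relations on $M$; $G$ or $R$ may be empty. It is a total algebra if $R=\varnothing$ and purely relational if $G=\varnothing$; non-trivial means having more than one element. Operations and relations are lifted pointwise to powers. A substructure ($\le$) is a subset closed under the operations, with the restricted relations; substructures of structures without topology are non-empty. Homomorphisms preserve all operations and relations. A total structure with topology $\widetilde{\mathbf M}=\langle M;G,R,\mathcal T\rangle$ also carries a compact Hausdorff topology $\mathcal T$ on $M$ (no compatibility of structure and topology is assumed); purely structural notions applied to $\widetilde{\mathbf M}$ (term functions, substructures of $\widetilde{\mathbf M}^n$, etc.) refer to the structure with the topology removed. **Classes.** $\mathbb{ISP}(\mathbf M)$ is the category of all (non-empty) structures isomorphic to substructures of powers of $\mathbf M$, with homomorphisms as morphisms. $\mathbb{IS}_c\mathbb P^+(\widetilde{\mathbf M})$ is the category of all structures with topology isomorphic to topologically closed substructures of powers $\widetilde{\mathbf M}^S$ with $S\neq\varnothing$ (product topology), with continuous homomorphisms as morphisms; the empty structure belongs to it if the type of $\widetilde{\mathbf M}$ has no nullary operations. $\mathcal C(\mathbf A,\mathbf B)$ denotes the set of morphisms in a category $\mathcal C$. Embeddings are isomorphisms onto substructures in $\mathbb{ISP}(\mathbf M)$ and isomorphisms onto topologically closed substructures in $\mathbb{IS}_c\mathbb P^+(\widetilde{\mathbf M})$; injectivity is with respect to these embeddings. **Alter egos.** $\widetilde{\mathbf M}=\langle M;G_2,R_2,\mathcal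 T\rangle$ is an alter ego of $\mathbf M=\langle M;G_1,R_1\rangle$ if each $n$-ary $r\in R_2$ forms a substructure of $\mathbf M^n$, each $n$-ary $g\in G_2$ is a homomorphism $\mathbf M^n\to\mathbf M$, each relation in $R_1$ is topologically closed and each operation in $G_1$ is continuous with respect to $\mathcal T$. **Dualities.** Let $\widetilde{\mathbf M}$ be an alter ego of $\mathbf M$, $\mathcal A=\mathbb{ISP}(\mathbf M)$, $\mathcal X=\mathbb{IS}_c\mathbb P^+(\widetilde{\mathbf M})$. For $\mathbf A\in\mathcal A$, $\mathcal A(\mathbf A,\mathbf M)$ is a closed substructure of $\widetilde{\mathbf M}^A$, giving $\mathrm D(\mathbf A)\in\mathcal X$; for $\mathbf X\in\mathcal X$, $\mathcal X(\mathbf X,\widetilde{\mathbf M})$ is a substructure of $\mathbf M^X$, giving $\mathrm E(\mathbf X)\in\mathcal A$. The evaluation maps are $e_{\mathbf A}\colon\mathbf A\to\mathrm{ED}(\mathbf A)$, $e_{\mathbf A}(a)(x)=x(a)$, and $\varepsilon_{\mathbf X}\colon\mathbf X\to\mathrm{DE}(\mathbf X)$, $\varepsilon_{\mathbf X}(x)(\alpha)=\alpha(x)$. $\widetilde{\mathbf M}$ dualises $\mathbf M$ if $e_{\mathbf A}$ is an isomorphism for all $\mathbf A\in\mathcal A$; it co-dualises $\mathbf M$ if $\varepsilon_{\mathbf X}$ is an isomorphism for all $\mathbf X\in\mathcal X$; it fully dualises $\mathbf M$ if both hold. **Term functions and separation.** $\mathrm{Clo}_1(\cdot)$ is the set of unary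 term functions. For sets of maps, $\Omega\circ\mathcal E=\{\omega\circ u\mid\omega\in\Omega,u\in\mathcal E\}$, and $\omega\circ\mathcal E=\{\omega\}\circ\mathcal E$. A set $Z$ of maps from $A$ to $N$ separates the points of $A$ if for all $a\ne b$ in $A$ some $z\in Z$ has $z(a)\neq z(b)$; it separates the structure $\mathbf A$ (with $\mathbf A$, $\mathbf N$ of the same type) if it separates the points and, for every $n$-ary relation symbol $r$ of the type and $(a_1,\dots,a_n)\notin r^{\mathbf A}$, some $z\in Z$ has $(z(a_1),\dots,z(a_n))\notin r^{\mathbf N}$. **Structural reducts.** $\langle M;G',R'\rangle$ is a structural reduct of $\langle M;G,R\rangle$ if each operation in $G'$ is a term function of $\langle M;G,R\rangle$ (a nullary term function if nullary) and each relation in $R'$ is conjunct-atomic definable, i.e. is the set of tuples satisfying a finite conjunction of atomic formulas in the language $\langle G,R\rangle$ (with equality). "$\mathbf M$ has a structural reduct $\mathbf M^\flat$ in $\mathcal B=\mathbb{ISP}(\mathbf N)$" means $\mathbf M^\flat$ is a structural reduct of the type of $\mathbf N$ with $\mathbf M^\flat\in\mathcal B$. "$\widetilde{\mathbf M}$ has a structural reduct $\widetilde{\mathbf M}^\flat$ in $\mathcal Y=\mathbb{IS}_c\mathbb P^+(\widetilde{\mathbf N})$" means that $\widetilde{\mathbf M}^\flat$, of the type of $\widetilde{\mathbf N}$ and with the same topology as $\widetilde{\mathbf M}$, has underlying structure a structural reduct of that of $\widetilde{\mathbf M}$, and $\widetilde{\mathbf M}^\flat\in\mathcal Y$. **Maximal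 relations and entailment.** For $r\subseteq N^n$ and $\omega_1,\dots,\omega_n\colon M\to N$, $(\omega_1,\dots,\omega_n)^{-1}(r)=\{(a_1,\dots,a_n)\in M^n\mid(\omega_1(a_1),\dots,\omega_n(a_n))\in r\}$. For $\Omega\subseteq N^M$, $\max_{\mathbf M}\Omega^{-1}(r)$ is the set of all $s\subseteq M^n$ forming a substructure of $\mathbf M^n$ that is maximal (among substructures) in $(\omega_1,\dots,\omega_n)^{-1}(r)$ for some $\omega_1,\dots,\omega_n\in\Omega$. $\Delta_N=\{(a,a)\mid a\in N\}$ and $\ker(\omega)=(\omega,\omega)^{-1}(\Delta_N)$. $\widetilde{\mathbf M}$ entails $r\subseteq M^n$ if $r$ forms a substructure of $\mathbf M^n$ and, for all $\mathbf A\in\mathcal A$, every $\mathcal X$-morphism $\alpha\colon\mathcal A(\mathbf A,\mathbf M)\to\widetilde{\mathbf M}$ preserves $r$ (lifted pointwise to $\mathcal A(\mathbf A,\mathbf M)$). *)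

theory Defs
  imports "HOL-Analysis.Analysis"
begin

section \<open>Structures\<close>

text \<open>
  A type (similarity type) consists of sets of operation and relation symbols with arities.
  The symbols form sets, rather than whole HOL types, since either set may be empty.
  Tuples are lists; an operation or relation is only meaningful on tuples over the carrier
  whose length is the arity of the symbol.
\<close>

record ('f, 'r) signature =
  opsyms :: "'f set"
  relsyms :: "'r set"
  oparity :: "'f \<Rightarrow> nat"
  relarity :: "'r \<Rightarrow> nat"

record ('a, 'f, 'r) fo_struct =
  sig :: "('f, 'r) signature"
  carrier :: "'a set"
  opn :: "'f \<Rightarrow> 'a list \<Rightarrow> 'a"
  rln :: "'r \<Rightarrow> 'a list set"

text \<open>
  A structure with topology extends the record of a structure, so every purely structural notion
  below, being stated for the record scheme, applies to it and ignores its topology.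
\<close>

record ('a, 'f, 'r) fo_tstruct = "('a, 'f, 'r) fo_struct" +
  tplgy :: "'a topology"

abbreviation ops :: "('a, 'f, 'r, 'z) fo_struct_scheme \<Rightarrow> 'f set" where
  "ops A \<equiv> opsyms (sig A)"

abbreviation rels :: "('a, 'f, 'r, 'z) fo_struct_scheme \<Rightarrow> 'r set" where
  "rels A \<equiv> relsyms (sig A)"

abbreviation oar :: "('a, 'f, 'r, 'z) fo_struct_scheme \<Rightarrow> 'f \<Rightarrow> nat" where
  "oar A \<equiv> oparity (sig A)"

abbreviation rar :: "('a, 'f, 'r, 'z) fo_struct_scheme \<Rightarrow> 'r \<Rightarrow> nat" where
  "rar A \<equiv> relarity (sig A)"

definition tuples :: "'a set \<Rightarrow> nat \<Rightarrow> 'a list set" where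
  "tuples D n = {xs. length xs = n \<and> set xs \<subseteq> D}"

definition is_struct :: "('a, 'f, 'r, 'z) fo_struct_scheme \<Rightarrow> bool" where
  "is_struct A \<longleftrightarrow>
     (\<forall>f\<in>ops A. \<forall>xs\<in>tuples (carrier A) (oar A f). opn A f xs \<in> carrier A) \<and>
     (\<forall>r\<in>rels A. rln A r \<subseteq> tuples (carrier A) (rar A r))"

text \<open>
  The carrier and the relations are required to be non-empty only for the generating structures:
  members of the classes generated by them may have empty relations, and in the topological case
  may be empty.
\<close>

definition total_structure :: "('a, 'f, 'r, 'z) fo_struct_scheme \<Rightarrow> bool" where
  "total_structure M \<longleftrightarrow> is_struct M \<and> carrier M \<noteq> {} \<and> (\<forall>r\<in>rels M. rln M r \<noteq> {})"

definition nontrivial :: "('a, 'f, 'r, 'z) fo_struct_scheme \<Rightarrow> bool" where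
  "nontrivial M \<longleftrightarrow> (\<exists>a\<in>carrier M. \<exists>b\<in>carrier M. a \<noteq> b)"

definition purely_relational :: "('a, 'f, 'r, 'z) fo_struct_scheme \<Rightarrow> bool" where
  "purely_relational M \<longleftrightarrow> ops M = {}"

definition is_tstruct :: "('a, 'f, 'r, 'z) fo_tstruct_scheme \<Rightarrow> bool" where
  "is_tstruct X \<longleftrightarrow> is_struct X \<and> topspace (tplgy X) = carrier X"

definition total_tstructure :: "('a, 'f, 'r, 'z) fo_tstruct_scheme \<Rightarrow> bool" where
  "total_tstructure M \<longleftrightarrow> total_structure M \<and> is_tstruct M \<and>
     compact_space (tplgy M) \<and> Hausdorff_space (tplgy M)"

section \<open>Substructures, powers, morphisms\<close>

definition subuniverse :: "('a, 'f, 'r, 'z) fo_struct_scheme \<Rightarrow> 'a set \<Rightarrow> bool" where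
  "subuniverse A D \<longleftrightarrow> D \<subseteq> carrier A \<and>
     (\<forall>f\<in>ops A. \<forall>xs\<in>tuples D (oar A f). opn A f xs \<in> D)"

definition substructure :: "('a, 'f, 'r, 'z) fo_struct_scheme \<Rightarrow> 'a set \<Rightarrow> bool" where
  "substructure A D \<longleftrightarrow> D \<noteq> {} \<and> subuniverse A D"

definition closed_substructure :: "('a, 'f, 'r, 'z) fo_tstruct_scheme \<Rightarrow> 'a set \<Rightarrow> bool" where
  "closed_substructure X D \<longleftrightarrow> subuniverse X D \<and> closedin (tplgy X) D"

definition induced :: "('a, 'f, 'r, 'z) fo_struct_scheme \<Rightarrow> 'a set \<Rightarrow> ('a, 'f, 'r) fo_struct" where
  "induced A D = \<lparr>sig = sig A, carrier = D, opn = opn A,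
     rln = (\<lambda>r. {xs \<in> rln A r. set xs \<subseteq> D})\<rparr>"

definition tinduced :: "('a, 'f, 'r, 'z) fo_tstruct_scheme \<Rightarrow> 'a set \<Rightarrow> ('a, 'f, 'r) fo_tstruct" where
  "tinduced X D = \<lparr>sig = sig X, carrier = D, opn = opn X,
     rln = (\<lambda>r. {xs \<in> rln X r. set xs \<subseteq> D}), tplgy = subtopology (tplgy X) D\<rparr>"

text \<open>
  Powers with an arbitrary index set consist of extensional functions; the finite powers used for
  relations and operations on the base set consist of lists.
\<close>

definition spower :: "('a, 'f, 'r, 'z) fo_struct_scheme \<Rightarrow> 's set \<Rightarrow> ('s \<Rightarrow> 'a, 'f, 'r) fo_struct" where
  "spower M S = \<lparr>sig = sig M, carrier = (\<Pi>\<^sub>E s\<in>S. carrier M),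
     opn = (\<lambda>f xs. \<lambda>s\<in>S. opn M f (map (\<lambda>x. x s) xs)),
     rln = (\<lambda>r. {xs \<in> tuples (\<Pi>\<^sub>E s\<in>S. carrier M) (rar M r).
                   \<forall>s\<in>S. map (\<lambda>x. x s) xs \<in> rln M r})\<rparr>"

definition tpower :: "('a, 'f, 'r, 'z) fo_tstruct_scheme \<Rightarrow> 's set \<Rightarrow> ('s \<Rightarrow> 'a, 'f, 'r) fo_tstruct" where
  "tpower M S = \<lparr>sig = sig M, carrier = carrier (spower M S), opn = opn (spower M S),
     rln = rln (spower M S), tplgy = product_topology (\<lambda>s. tplgy M) S\<rparr>"

definition fpower :: "('a, 'f, 'r, 'z) fo_struct_scheme \<Rightarrow> nat \<Rightarrow> ('a list, 'f, 'r) fo_struct" where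
  "fpower M n = \<lparr>sig = sig M, carrier = tuples (carrier M) n,
     opn = (\<lambda>f xs. map (\<lambda>i. opn M f (map (\<lambda>x. x ! i) xs)) [0..<n]),
     rln = (\<lambda>r. {xs \<in> tuples (tuples (carrier M) n) (rar M r).
                   \<forall>i<n. map (\<lambda>x. x ! i) xs \<in> rln M r})\<rparr>"

definition is_hom ::
  "('a, 'f, 'r, 'y) fo_struct_scheme \<Rightarrow> ('b, 'f, 'r, 'z) fo_struct_scheme \<Rightarrow> ('a \<Rightarrow> 'b) \<Rightarrow> bool" where
  "is_hom A B h \<longleftrightarrow> sig A = sig B \<and> h ` carrier A \<subseteq> carrier B \<and>
     (\<forall>f\<in>ops A. \<forall>xs\<in>tuples (carrier A) (oar A f). h (opn A f xs) = opn B f (map h xs)) \<and>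
     (\<forall>r\<in>rels A. \<forall>xs\<in>tuples (carrier A) (rar A r). xs \<in> rln A r \<longrightarrow> map h xs \<in> rln B r)"

definition is_iso ::
  "('a, 'f, 'r, 'y) fo_struct_scheme \<Rightarrow> ('b, 'f, 'r, 'z) fo_struct_scheme \<Rightarrow> ('a \<Rightarrow> 'b) \<Rightarrow> bool" where
  "is_iso A B h \<longleftrightarrow> is_hom A B h \<and> bij_betw h (carrier A) (carrier B) \<and>
     is_hom B A (inv_into (carrier A) h)"

definition is_tiso ::
  "('a, 'f, 'r, 'y) fo_tstruct_scheme \<Rightarrow> ('b, 'f, 'r, 'z) fo_tstruct_scheme \<Rightarrow> ('a \<Rightarrow> 'b) \<Rightarrow> bool" where
  "is_tiso X Y h \<longleftrightarrow> is_iso X Y h \<and> homeomorphic_map (tplgy X) (tplgy Y) h"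

text \<open>
  Hom-sets consist of extensional functions, so that distinct members differ on the carrier.
\<close>

definition homs ::
  "('a, 'f, 'r, 'y) fo_struct_scheme \<Rightarrow> ('b, 'f, 'r, 'z) fo_struct_scheme \<Rightarrow> ('a \<Rightarrow> 'b) set" where
  "homs A B = {h \<in> extensional (carrier A). is_hom A B h}"

definition thoms ::
  "('a, 'f, 'r, 'y) fo_tstruct_scheme \<Rightarrow> ('b, 'f, 'r, 'z) fo_tstruct_scheme \<Rightarrow> ('a \<Rightarrow> 'b) set" where
  "thoms X Y = {h \<in> homs X Y. continuous_map (tplgy X) (tplgy Y) h}"

definition is_embedding ::
  "('a, 'f, 'r, 'y) fo_struct_scheme \<Rightarrow> ('b, 'f, 'r, 'z) fo_struct_scheme \<Rightarrow> ('a \<Rightarrow> 'b) \<Rightarrow> bool" where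
  "is_embedding A B h \<longleftrightarrow> (\<exists>D. substructure B D \<and> is_iso A (induced B D) h)"

definition is_tembedding ::
  "('a, 'f, 'r, 'y) fo_tstruct_scheme \<Rightarrow> ('b, 'f, 'r, 'z) fo_tstruct_scheme \<Rightarrow> ('a \<Rightarrow> 'b) \<Rightarrow> bool" where
  "is_tembedding X Y h \<longleftrightarrow> (\<exists>D. closed_substructure Y D \<and> is_tiso X (tinduced Y D) h)"

section \<open>The generated classes and injectivity\<close>

text \<open>
  The index set of the power ranges over sets of maps from the structure to the generator.
  This is no restriction: if a structure embeds into a power with an index set of any type, then it
  embeds into the power indexed by its own morphisms to the generator; see the lemmas
  \<open>in_ISP_any_index\<close> and \<open>in_IScP_any_index\<close> below.
  The index set may be empty for \<open>in_ISP\<close> but not for \<open>in_IScP\<close>.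
\<close>

definition in_ISP :: "('m, 'f, 'r, 'y) fo_struct_scheme \<Rightarrow> ('a, 'f, 'r, 'z) fo_struct_scheme \<Rightarrow> bool" where
  "in_ISP M A \<longleftrightarrow> is_struct A \<and> carrier A \<noteq> {} \<and>
     (\<exists>(S :: ('a \<Rightarrow> 'm) set) h. is_embedding A (spower M S) h)"

definition in_IScP :: "('m, 'f, 'r, 'y) fo_tstruct_scheme \<Rightarrow> ('a, 'f, 'r, 'z) fo_tstruct_scheme \<Rightarrow> bool" where
  "in_IScP M X \<longleftrightarrow> is_tstruct X \<and>
     (\<exists>(S :: ('a \<Rightarrow> 'm) set) h. S \<noteq> {} \<and> is_tembedding X (tpower M S) h)"

lemma induced_simps [simp]:
  "sig (induced A D) = sig A" "carrier (induced A D) = D" "opn (induced A D) = opn A"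
  "rln (induced A D) r = {xs \<in> rln A r. set xs \<subseteq> D}"
  by (simp_all add: induced_def)

lemma tinduced_simps [simp]:
  "sig (tinduced X D) = sig X" "carrier (tinduced X D) = D" "opn (tinduced X D) = opn X"
  "rln (tinduced X D) r = {xs \<in> rln X r. set xs \<subseteq> D}"
  "tplgy (tinduced X D) = subtopology (tplgy X) D"
  by (simp_all add: tinduced_def)

lemma spower_simps [simp]:
  "sig (spower M S) = sig M" "carrier (spower M S) = (\<Pi>\<^sub>E s\<in>S. carrier M)"
  "opn (spower M S) f xs = (\<lambda>s\<in>S. opn M f (map (\<lambda>x. x s) xs))"
  "rln (spower M S) r =
    {xs \<in> tuples (\<Pi>\<^sub>E s\<in>S. carrier M) (rar M r). \<forall>s\<in>S. map (\<lambda>x. x s) xs \<in> rln M r}"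
  by (simp_all add: spower_def)

lemma tpower_simps [simp]:
  "sig (tpower M S) = sig M" "carrier (tpower M S) = carrier (spower M S)"
  "opn (tpower M S) = opn (spower M S)" "rln (tpower M S) = rln (spower M S)"
  "tplgy (tpower M S) = product_topology (\<lambda>s. tplgy M) S"
  by (simp_all add: tpower_def)

lemma tuples_map: "h ` D \<subseteq> E \<Longrightarrow> xs \<in> tuples D n \<Longrightarrow> map h xs \<in> tuples E n"
  by (auto simp: tuples_def)

lemma is_iso_induced_tinduced:
  "is_iso A (tinduced (tpower M S) D) h \<longleftrightarrow> is_iso A (induced (spower M S) D) h"
  by (simp add: is_iso_def is_hom_def)

lemma subuniverse_tpower: "subuniverse (tpower M S) D \<longleftrightarrow> subuniverse (spower M S) D"
  by (simp add: subuniverse_def)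

lemma power_coords:
  fixes A :: "('a, 'f, 'r, 'y) fo_struct_scheme" and M :: "('m, 'f, 'r, 'z) fo_struct_scheme"
  assumes A: "is_struct A" and D: "subuniverse (spower M S) D"
    and iso: "is_iso A (induced (spower M S) D) h"
  defines "p \<equiv> \<lambda>s. \<lambda>a\<in>carrier A. h a s"
  shows "sig A = sig M"
    and "\<And>s. s \<in> S \<Longrightarrow> p s \<in> homs A M"
    and "\<And>a b. a \<in> carrier A \<Longrightarrow> b \<in> carrier A \<Longrightarrow> (\<And>s. s \<in> S \<Longrightarrow> p s a = p s b) \<Longrightarrow> a = b"
    and "\<And>r xs. r \<in> rels A \<Longrightarrow> xs \<in> tuples (carrier A) (rar A r) \<Longrightarrow>
           (\<And>s. s \<in> S \<Longrightarrow> map (p s) xs \<in> rln M r) \<Longrightarrow> xs \<in> rln A r"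
proof -
  have hom: "is_hom A (induced (spower M S) D) h"
    and bij: "bij_betw h (carrier A) D"
    and inv: "is_hom (induced (spower M S) D) A (inv_into (carrier A) h)"
    using iso by (auto simp: is_iso_def)
  show sg: "sig A = sig M" using hom by (simp add: is_hom_def)
  have hD: "h a \<in> D" if "a \<in> carrier A" for a using bij that by (auto simp: bij_betw_def)
  have DP: "D \<subseteq> (\<Pi>\<^sub>E s\<in>S. carrier M)" using D by (simp add: subuniverse_def)
  have mp: "map (p s) xs = map (\<lambda>x. x s) (map h xs)" if "set xs \<subseteq> carrier A" for s xs
    using that by (auto simp: p_def)
  show "p s \<in> homs A M" if s: "s \<in> S" for s
    unfolding homs_def is_hom_def
  proof (intro CollectI conjI ballI impI)
    show "p s \<in> extensional (carrier A)" by (simp add: p_def)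
    show "sig A = sig M" by fact
    show "p s ` carrier A \<subseteq> carrier M" using hD DP s by (fastforce simp: p_def)
  next
    fix f xs assume f: "f \<in> ops A" and xs: "xs \<in> tuples (carrier A) (oar A f)"
    then have "opn A f xs \<in> carrier A" using A by (auto simp: is_struct_def)
    moreover have "h (opn A f xs) = opn (spower M S) f (map h xs)"
      using hom f xs by (simp add: is_hom_def)
    ultimately show "p s (opn A f xs) = opn M f (map (p s) xs)"
      using s mp[of xs s] xs by (simp add: p_def tuples_def del: map_eq_conv)
  next
    fix r xs assume r: "r \<in> rels A" and xs: "xs \<in> tuples (carrier A) (rar A r)" "xs \<in> rln A r"
    then have "map h xs \<in> rln (spower M S) r" using hom by (simp add: is_hom_def)
    then show "map (p s) xs \<in> rln M r"
      using s mp[of xs s] xs by (simp add: tuples_def del: map_eq_conv)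
  qed
  show "a = b" if a: "a \<in> carrier A" and b: "b \<in> carrier A"
    and eq: "\<And>s. s \<in> S \<Longrightarrow> p s a = p s b" for a b
  proof -
    have "h a = h b"
      using hD[OF a] hD[OF b] DP eq a b by (intro PiE_ext[of _ S "\<lambda>_. carrier M"]) (auto simp: p_def)
    then show ?thesis using bij a b by (auto simp: bij_betw_def inj_on_def)
  qed
  show "xs \<in> rln A r" if r: "r \<in> rels A" and xs: "xs \<in> tuples (carrier A) (rar A r)"
    and R: "\<And>s. s \<in> S \<Longrightarrow> map (p s) xs \<in> rln M r" for r xs
  proof -
    have sx: "set xs \<subseteq> carrier A" using xs by (simp add: tuples_def)
    have t: "map h xs \<in> tuples D (rar M r)"
      using xs hD sg by (auto simp: tuples_def)
    have "map h xs \<in> tuples (\<Pi>\<^sub>E s\<in>S. carrier M) (rar M r)"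
      using t DP unfolding tuples_def by blast
    then have "map h xs \<in> rln (spower M S) r"
      using R mp[OF sx] by simp
    then have "map (inv_into (carrier A) h) (map h xs) \<in> rln A r"
      using inv r t sg unfolding is_hom_def
      by (simp add: tuples_def del: map_map spower_simps(4))
    moreover have "map (inv_into (carrier A) h) (map h xs) = xs"
      using sx bij by (auto simp: bij_betw_def intro!: map_idI)
    ultimately show ?thesis by simp
  qed
qed

lemma canonical_map:
  fixes A :: "('a, 'f, 'r, 'y) fo_struct_scheme" and M :: "('m, 'f, 'r, 'z) fo_struct_scheme"
  assumes A: "is_struct A" and sg: "sig A = sig M" and S: "S \<subseteq> homs A M"
    and Sep: "\<forall>a\<in>carrier A. \<forall>b\<in>carrier A. (\<forall>x\<in>S. x a = x b) \<longrightarrow> a = b"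
    and Refl: "\<forall>r\<in>rels A. \<forall>xs\<in>tuples (carrier A) (rar A r).
                 (\<forall>x\<in>S. map x xs \<in> rln M r) \<longrightarrow> xs \<in> rln A r"
  defines "k \<equiv> \<lambda>a. \<lambda>x\<in>S. x a"
  shows "subuniverse (spower M S) (k ` carrier A)"
    and "is_iso A (induced (spower M S) (k ` carrier A)) k"
proof -
  have sep: "a = b" if "a \<in> carrier A" "b \<in> carrier A" "\<And>x. x \<in> S \<Longrightarrow> x a = x b" for a b
    using Sep that by simp
  have refl: "xs \<in> rln A r" if "r \<in> rels A" "xs \<in> tuples (carrier A) (rar A r)"
    "\<And>x. x \<in> S \<Longrightarrow> map x xs \<in> rln M r" for r xs
    using Refl that by simp
  have hom: "is_hom A M x" if "x \<in> S" for x using S that by (auto simp: homs_def)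
  have inj: "inj_on k (carrier A)"
  proof (rule inj_onI)
    fix a b assume "a \<in> carrier A" "b \<in> carrier A" "k a = k b"
    moreover have "x a = x b" if "x \<in> S" for x
      using fun_cong[OF \<open>k a = k b\<close>, of x] that by (simp add: k_def)
    ultimately show "a = b" by (intro sep)
  qed
  have mk: "map (\<lambda>y. y x) (map k xs) = map x xs" if "x \<in> S" for x xs
    using that by (simp add: k_def)
  have kP: "k a \<in> (\<Pi>\<^sub>E x\<in>S. carrier M)" if "a \<in> carrier A" for a
    using hom that by (fastforce simp: k_def is_hom_def)
  have kop: "k (opn A f xs) = opn (spower M S) f (map k xs)"
    if "f \<in> ops A" "xs \<in> tuples (carrier A) (oar A f)" for f xs
    using hom that by (auto simp: k_def is_hom_def comp_def intro!: restrict_ext)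
  have pre: "\<exists>xs. ys = map k xs \<and> xs \<in> tuples (carrier A) n" if "ys \<in> tuples (k ` carrier A) n" for ys n
    using that by (intro exI[of _ "map (inv_into (carrier A) k) ys"])
      (auto simp: tuples_def f_inv_into_f inv_into_into subset_iff intro!: map_idI[symmetric])
  have Aop: "opn A f xs \<in> carrier A"
    if "f \<in> ops A" "xs \<in> tuples (carrier A) (oar A f)" for f xs
    using A that by (auto simp: is_struct_def)
  show "subuniverse (spower M S) (k ` carrier A)"
    unfolding subuniverse_def
  proof (intro conjI ballI)
    show "k ` carrier A \<subseteq> carrier (spower M S)" using kP by auto
    fix f ys assume "f \<in> ops (spower M S)" "ys \<in> tuples (k ` carrier A) (oar (spower M S) f)"
    then show "opn (spower M S) f ys \<in> k ` carrier A"
      using pre[of ys] kop Aop sg by (metis imageI spower_simps(1))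
  qed
  have inv: "map (inv_into (carrier A) k) (map k xs) = xs" if "set xs \<subseteq> carrier A" for xs
    using that inj by (auto intro!: map_idI)
  have rel: "map k xs \<in> rln (spower M S) r \<longleftrightarrow> xs \<in> rln A r"
    if "r \<in> rels A" "xs \<in> tuples (carrier A) (rar A r)" for r xs
  proof -
    have "map k xs \<in> tuples (\<Pi>\<^sub>E x\<in>S. carrier M) (rar M r)"
      using that kP sg by (auto simp: tuples_def)
    then show ?thesis
      using that refl[OF that] hom mk[of _ xs] by (auto simp: is_hom_def simp del: map_map)
  qed
  show "is_iso A (induced (spower M S) (k ` carrier A)) k"
    unfolding is_iso_def
  proof (intro conjI)
    show "is_hom A (induced (spower M S) (k ` carrier A)) k"
      using sg kop rel unfolding is_hom_def by (auto simp: tuples_def simp del: spower_simps(3,4))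
    show "bij_betw k (carrier A) (carrier (induced (spower M S) (k ` carrier A)))"
      using inj by (simp add: bij_betw_def)
    show "is_hom (induced (spower M S) (k ` carrier A)) A (inv_into (carrier A) k)"
      unfolding is_hom_def
    proof (intro conjI ballI impI)
      fix f ys assume "f \<in> ops (induced (spower M S) (k ` carrier A))"
        "ys \<in> tuples (carrier (induced (spower M S) (k ` carrier A)))
               (oar (induced (spower M S) (k ` carrier A)) f)"
      then obtain xs where f: "f \<in> ops A" and ys: "ys = map k xs" and xs: "xs \<in> tuples (carrier A) (oar A f)"
        using pre sg by (metis induced_simps(1,2) spower_simps(1))
      show "inv_into (carrier A) k (opn (induced (spower M S) (k ` carrier A)) f ys) =
        opn A f (map (inv_into (carrier A) k) ys)"
        using kop[OF f xs, symmetric] inv[of xs] xs Aop[OF f xs] inj ys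
        by (simp add: tuples_def del: spower_simps(3))
    next
      fix r ys assume "r \<in> rels (induced (spower M S) (k ` carrier A))"
        "ys \<in> tuples (carrier (induced (spower M S) (k ` carrier A)))
               (rar (induced (spower M S) (k ` carrier A)) r)"
        and R: "ys \<in> rln (induced (spower M S) (k ` carrier A)) r"
      then obtain xs where r: "r \<in> rels A" and ys: "ys = map k xs" and xs: "xs \<in> tuples (carrier A) (rar A r)"
        using pre sg by (metis induced_simps(1,2) spower_simps(1))
      show "map (inv_into (carrier A) k) ys \<in> rln A r"
        using rel[OF r xs] R inv[of xs] xs unfolding ys
        by (simp add: tuples_def del: spower_simps(4) map_map)
    qed (use sg in \<open>auto simp: inv_into_into\<close>)
  qed
qed

lemma in_ISP_any_index:
  fixes M :: "('m, 'f, 'r, 'y) fo_struct_scheme" and A :: "('a, 'f, 'r, 'z) fo_struct_scheme"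
    and S :: "'s set"
  assumes A: "is_struct A" "carrier A \<noteq> {}" and "is_embedding A (spower M S) h"
  shows "in_ISP M A"
proof -
  obtain D where D: "subuniverse (spower M S) D" and iso: "is_iso A (induced (spower M S) D) h"
    using assms(3) by (auto simp: is_embedding_def substructure_def)
  note p = power_coords[OF A(1) D iso]
  let ?k = "\<lambda>a. \<lambda>x\<in>homs A M. x a"
  have sep: "\<forall>a\<in>carrier A. \<forall>b\<in>carrier A. (\<forall>x\<in>homs A M. x a = x b) \<longrightarrow> a = b"
  proof (intro ballI impI)
    fix a b assume ab: "a \<in> carrier A" "b \<in> carrier A" and eq: "\<forall>x\<in>homs A M. x a = x b"
    show "a = b" by (rule p(3)[OF ab]) (rule bspec[OF eq p(2)])
  qed
  have refl: "\<forall>r\<in>rels A. \<forall>xs\<in>tuples (carrier A) (rar A r).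
                (\<forall>x\<in>homs A M. map x xs \<in> rln M r) \<longrightarrow> xs \<in> rln A r"
  proof (intro ballI impI)
    fix r xs assume r: "r \<in> rels A" "xs \<in> tuples (carrier A) (rar A r)"
      and R: "\<forall>x\<in>homs A M. map x xs \<in> rln M r"
    show "xs \<in> rln A r" by (rule p(4)[OF r]) (rule bspec[OF R p(2)])
  qed
  note k = canonical_map[OF A(1) p(1) order_refl sep refl]
  have "is_embedding A (spower M (homs A M)) ?k"
    unfolding is_embedding_def substructure_def
    using k A(2) by (intro exI[of _ "?k ` carrier A"]) (simp only: image_is_empty simp_thms)
  then show ?thesis
    unfolding in_ISP_def using A by (intro conjI exI[of _ "homs A M"] exI[of _ ?k])
qed

lemma in_IScP_any_index:
  fixes M :: "('m, 'f, 'r, 'y) fo_tstruct_scheme" and X :: "('a, 'f, 'r, 'z) fo_tstruct_scheme"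
    and S :: "'s set"
  assumes M: "total_tstructure M" and X: "is_tstruct X"
    and "S \<noteq> {}" "is_tembedding X (tpower M S) h"
  shows "in_IScP M X"
proof -
  obtain D where "closed_substructure (tpower M S) D" "is_tiso X (tinduced (tpower M S) D) h"
    using assms(4) by (auto simp: is_tembedding_def)
  then have D: "subuniverse (spower M S) D" and cl: "closedin (product_topology (\<lambda>s. tplgy M) S) D"
    and iso: "is_iso X (induced (spower M S) D) h"
    and hm: "homeomorphic_map (tplgy X) (subtopology (product_topology (\<lambda>s. tplgy M) S) D) h"
    by (auto simp: closed_substructure_def is_tiso_def subuniverse_tpower is_iso_induced_tinduced)
  have XA: "is_struct X" and tX: "topspace (tplgy X) = carrier X" using X by (auto simp: is_tstruct_def)
  have cM: "compact_space (tplgy M)" and hM: "Hausdorff_space (tplgy M)"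
    and tM: "topspace (tplgy M) = carrier M"
    using M by (auto simp: total_tstructure_def is_tstruct_def)
  note p = power_coords[OF XA D iso]
  let ?p = "\<lambda>s. \<lambda>a\<in>carrier X. h a s"
  have pc: "?p s \<in> thoms X M" if "s \<in> S" for s
  proof -
    have "continuous_map (tplgy X) (product_topology (\<lambda>s. tplgy M) S) h"
      using hm homeomorphic_imp_continuous_map continuous_map_in_subtopology by blast
    then have "continuous_map (tplgy X) (tplgy M) (\<lambda>a. h a s)"
      using that by (auto simp: continuous_map_componentwise)
    then have "continuous_map (tplgy X) (tplgy M) (?p s)"
      by (rule continuous_map_eq) (simp add: tX)
    then show ?thesis using p(2)[OF that] by (simp add: thoms_def)
  qed
  have ne: "thoms X M \<noteq> {}" using pc assms(3) by blast
  let ?k = "\<lambda>a. \<lambda>x\<in>thoms X M. x a" and ?P = "product_topology (\<lambda>x. tplgy M) (thoms X M)"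
  have sep: "\<forall>a\<in>carrier X. \<forall>b\<in>carrier X. (\<forall>x\<in>thoms X M. x a = x b) \<longrightarrow> a = b"
  proof (intro ballI impI)
    fix a b assume ab: "a \<in> carrier X" "b \<in> carrier X" and eq: "\<forall>x\<in>thoms X M. x a = x b"
    show "a = b" by (rule p(3)[OF ab]) (rule bspec[OF eq pc])
  qed
  have refl: "\<forall>r\<in>rels X. \<forall>xs\<in>tuples (carrier X) (rar X r).
                (\<forall>x\<in>thoms X M. map x xs \<in> rln M r) \<longrightarrow> xs \<in> rln X r"
  proof (intro ballI impI)
    fix r xs assume r: "r \<in> rels X" "xs \<in> tuples (carrier X) (rar X r)"
      and R: "\<forall>x\<in>thoms X M. map x xs \<in> rln M r"
    show "xs \<in> rln X r" by (rule p(4)[OF r]) (rule bspec[OF R pc])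
  qed
  have "thoms X M \<subseteq> homs X M" by (auto simp: thoms_def)
  note k = canonical_map[OF XA p(1) this sep refl]
  have sub: "subuniverse (spower M (thoms X M)) (?k ` carrier X)"
    and kiso: "is_iso X (induced (spower M (thoms X M)) (?k ` carrier X)) ?k"
    by (fact k)+
  have kinj: "inj_on ?k (carrier X)" using kiso by (simp add: is_iso_def bij_betw_def)
  have kc: "continuous_map (tplgy X) ?P ?k"
  proof -
    have "continuous_map (tplgy X) (tplgy M) (\<lambda>a. ?k a x)" if "x \<in> thoms X M" for x
      using that by (simp add: thoms_def)
    then show ?thesis by (auto simp: continuous_map_componentwise)
  qed
  have cX: "compact_space (tplgy X)"
  proof -
    have "compact_space (product_topology (\<lambda>s. tplgy M) S)"
      using cM by (simp add: compact_space_product_topology)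
    then have "compact_space (subtopology (product_topology (\<lambda>s. tplgy M) S) D)"
      using cl closedin_compact_space compact_space_subtopology by blast
    then show ?thesis
      using hm homeomorphic_map_imp_homeomorphic_space homeomorphic_compact_space by blast
  qed
  have hP: "Hausdorff_space ?P" using hM by (simp add: Hausdorff_space_product_topology)
  have im: "closedin ?P (?k ` carrier X)"
    using image_compactin[OF _ kc, of "carrier X"] cX hP tX
    by (metis compact_space_def compactin_imp_closedin)
  have "homeomorphic_map (tplgy X) (subtopology ?P (?k ` carrier X)) ?k"
  proof (rule bijective_closed_imp_homeomorphic_map)
    show kc': "continuous_map (tplgy X) (subtopology ?P (?k ` carrier X)) ?k"
      using kc tX by (simp add: continuous_map_in_subtopology)
    show "closed_map (tplgy X) (subtopology ?P (?k ` carrier X)) ?k"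
      using continuous_imp_closed_map[OF kc' cX] hP Hausdorff_space_subtopology by blast
    show "?k ` topspace (tplgy X) = topspace (subtopology ?P (?k ` carrier X))"
      using tX closedin_subset[OF im] by auto
    show "inj_on ?k (topspace (tplgy X))" using kinj tX by simp
  qed
  then have "is_tembedding X (tpower M (thoms X M)) ?k"
    using sub kiso im
    unfolding is_tembedding_def closed_substructure_def is_tiso_def
    by (auto simp: subuniverse_tpower is_iso_induced_tinduced intro!: exI[of _ "?k ` carrier X"])
  then show ?thesis
    unfolding in_IScP_def using X ne by (intro conjI exI[of _ "thoms X M"] exI[of _ ?k])
qed

text \<open>
  HOL cannot quantify over types inside a formula.  A notion that quantifies over all members of
  a class therefore takes a type argument, over which the carriers of these members range.
\<close>

definition injective_in_ISP ::
  "'a itself \<Rightarrow> ('m, 'f, 'r, 'z) fo_struct_scheme \<Rightarrow> bool" where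
  "injective_in_ISP T M \<longleftrightarrow>
     (\<forall>(A :: ('a, 'f, 'r) fo_struct) (B :: ('a, 'f, 'r) fo_struct) e h.
        in_ISP M A \<and> in_ISP M B \<and> is_embedding A B e \<and> h \<in> homs A M \<longrightarrow>
        (\<exists>k\<in>homs B M. \<forall>a\<in>carrier A. k (e a) = h a))"

definition injective_in_IScP ::
  "'a itself \<Rightarrow> ('m, 'f, 'r, 'z) fo_tstruct_scheme \<Rightarrow> bool" where
  "injective_in_IScP T M \<longleftrightarrow>
     (\<forall>(X :: ('a, 'f, 'r) fo_tstruct) (Y :: ('a, 'f, 'r) fo_tstruct) e h.
        in_IScP M X \<and> in_IScP M Y \<and> is_tembedding X Y e \<and> h \<in> thoms X M \<longrightarrow>
        (\<exists>k\<in>thoms Y M. \<forall>x\<in>carrier X. k (e x) = h x))"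

section \<open>Alter egos and dualities\<close>

definition forms_substructure :: "('m, 'f, 'r, 'z) fo_struct_scheme \<Rightarrow> nat \<Rightarrow> 'm list set \<Rightarrow> bool" where
  "forms_substructure M n s \<longleftrightarrow> substructure (fpower M n) s"

text \<open>The topology on an \<open>n\<close>-th power lives on functions; this turns an \<open>n\<close>-tuple into one.\<close>

definition tuple_fun :: "nat \<Rightarrow> 'm list \<Rightarrow> nat \<Rightarrow> 'm" where
  "tuple_fun n xs = (\<lambda>i\<in>{..<n}. xs ! i)"

definition alter_ego ::
  "('m, 'f1, 'r1, 'y) fo_struct_scheme \<Rightarrow> ('m, 'f2, 'r2, 'z) fo_tstruct_scheme \<Rightarrow> bool" where
  "alter_ego M Mt \<longleftrightarrow> carrier Mt = carrier M \<and>
     (\<forall>r\<in>rels Mt. forms_substructure M (rar Mt r) (rln Mt r)) \<and>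
     (\<forall>g\<in>ops Mt. is_hom (fpower M (oar Mt g)) M (opn Mt g)) \<and>
     (\<forall>r\<in>rels M. closedin (product_topology (\<lambda>i. tplgy Mt) {..<rar M r})
                            (tuple_fun (rar M r) ` rln M r)) \<and>
     (\<forall>f\<in>ops M. continuous_map (product_topology (\<lambda>i. tplgy Mt) {..<oar M f}) (tplgy Mt)
                            (\<lambda>x. opn M f (map x [0..<oar M f])))"

definition dualD ::
  "('m, 'f1, 'r1, 'y) fo_struct_scheme \<Rightarrow> ('m, 'f2, 'r2, 'z) fo_tstruct_scheme \<Rightarrow>
   ('a, 'f1, 'r1, 'w) fo_struct_scheme \<Rightarrow> ('a \<Rightarrow> 'm, 'f2, 'r2) fo_tstruct" where
  "dualD M Mt A = tinduced (tpower Mt (carrier A)) (homs A M)"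

definition dualE ::
  "('m, 'f1, 'r1, 'y) fo_struct_scheme \<Rightarrow> ('m, 'f2, 'r2, 'z) fo_tstruct_scheme \<Rightarrow>
   ('a, 'f2, 'r2, 'w) fo_tstruct_scheme \<Rightarrow> ('a \<Rightarrow> 'm, 'f1, 'r1) fo_struct" where
  "dualE M Mt X = induced (spower M (carrier X)) (thoms X Mt)"

definition eval_e ::
  "('m, 'f1, 'r1, 'y) fo_struct_scheme \<Rightarrow> ('a, 'f1, 'r1, 'w) fo_struct_scheme \<Rightarrow>
   'a \<Rightarrow> ('a \<Rightarrow> 'm) \<Rightarrow> 'm" where
  "eval_e M A a = (\<lambda>x\<in>homs A M. x a)"

definition eval_eps ::
  "('m, 'f2, 'r2, 'z) fo_tstruct_scheme \<Rightarrow> ('a, 'f2, 'r2, 'w) fo_tstruct_scheme \<Rightarrow>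
   'a \<Rightarrow> ('a \<Rightarrow> 'm) \<Rightarrow> 'm" where
  "eval_eps Mt X x = (\<lambda>\<alpha>\<in>thoms X Mt. \<alpha> x)"

definition dualises ::
  "'a itself \<Rightarrow> ('m, 'f1, 'r1, 'y) fo_struct_scheme \<Rightarrow> ('m, 'f2, 'r2, 'z) fo_tstruct_scheme \<Rightarrow> bool" where
  "dualises T M Mt \<longleftrightarrow>
     (\<forall>A :: ('a, 'f1, 'r1) fo_struct. in_ISP M A \<longrightarrow>
        is_iso A (dualE M Mt (dualD M Mt A)) (eval_e M A))"

definition co_dualises ::
  "'a itself \<Rightarrow> ('m, 'f1, 'r1, 'y) fo_struct_scheme \<Rightarrow> ('m, 'f2, 'r2, 'z) fo_tstruct_scheme \<Rightarrow> bool" where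
  "co_dualises T M Mt \<longleftrightarrow>
     (\<forall>X :: ('a, 'f2, 'r2) fo_tstruct. in_IScP Mt X \<longrightarrow>
        is_tiso X (dualD M Mt (dualE M Mt X)) (eval_eps Mt X))"

definition fully_dualises ::
  "'a itself \<Rightarrow> 'x itself \<Rightarrow>
   ('m, 'f1, 'r1, 'y) fo_struct_scheme \<Rightarrow> ('m, 'f2, 'r2, 'z) fo_tstruct_scheme \<Rightarrow> bool" where
  "fully_dualises T U M Mt \<longleftrightarrow> dualises T M Mt \<and> co_dualises U M Mt"

section \<open>Term functions, separation, structural reducts\<close>

datatype 'f trm = Var nat | Fn 'f "'f trm list"

datatype ('f, 'r) atomic = Eq "'f trm" "'f trm" | Rel 'r "'f trm list"

text \<open>\<open>wf_trm \<sigma> n t\<close>: \<open>t\<close> is a term of type \<open>\<sigma>\<close> in the first \<open>n\<close> variables.\<close>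

fun wf_trm :: "('f, 'r) signature \<Rightarrow> nat \<Rightarrow> 'f trm \<Rightarrow> bool" where
  "wf_trm \<sigma> n (Var i) \<longleftrightarrow> i < n"
| "wf_trm \<sigma> n (Fn f ts) \<longleftrightarrow>
     f \<in> opsyms \<sigma> \<and> length ts = oparity \<sigma> f \<and> (\<forall>t\<in>set ts. wf_trm \<sigma> n t)"

fun wf_atomic :: "('f, 'r) signature \<Rightarrow> nat \<Rightarrow> ('f, 'r) atomic \<Rightarrow> bool" where
  "wf_atomic \<sigma> n (Eq t u) \<longleftrightarrow> wf_trm \<sigma> n t \<and> wf_trm \<sigma> n u"
| "wf_atomic \<sigma> n (Rel r ts) \<longleftrightarrow>
     r \<in> relsyms \<sigma> \<and> length ts = relarity \<sigma> r \<and> (\<forall>t\<in>set ts. wf_trm \<sigma> n t)"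

fun trm_val :: "('a, 'f, 'r, 'z) fo_struct_scheme \<Rightarrow> 'a list \<Rightarrow> 'f trm \<Rightarrow> 'a" where
  "trm_val A xs (Var i) = xs ! i"
| "trm_val A xs (Fn f ts) = opn A f (map (trm_val A xs) ts)"

fun satisfies :: "('a, 'f, 'r, 'z) fo_struct_scheme \<Rightarrow> 'a list \<Rightarrow> ('f, 'r) atomic \<Rightarrow> bool" where
  "satisfies A xs (Eq t u) \<longleftrightarrow> trm_val A xs t = trm_val A xs u"
| "satisfies A xs (Rel r ts) \<longleftrightarrow> map (trm_val A xs) ts \<in> rln A r"

text \<open>A 0-ary term function is given by a closed term, hence is a nullary term function.\<close>

definition is_term_function ::
  "('a, 'f, 'r, 'z) fo_struct_scheme \<Rightarrow> nat \<Rightarrow> ('a list \<Rightarrow> 'a) \<Rightarrow> bool" where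
  "is_term_function A n g \<longleftrightarrow>
     (\<exists>t. wf_trm (sig A) n t \<and> (\<forall>xs\<in>tuples (carrier A) n. g xs = trm_val A xs t))"

definition conjunct_atomic_definable ::
  "('a, 'f, 'r, 'z) fo_struct_scheme \<Rightarrow> nat \<Rightarrow> 'a list set \<Rightarrow> bool" where
  "conjunct_atomic_definable A n s \<longleftrightarrow>
     (\<exists>\<Phi>. finite \<Phi> \<and> (\<forall>\<phi>\<in>\<Phi>. wf_atomic (sig A) n \<phi>) \<and>
        s = {xs \<in> tuples (carrier A) n. \<forall>\<phi>\<in>\<Phi>. satisfies A xs \<phi>})"

definition structural_reduct ::
  "('a, 'f', 'r', 'y) fo_struct_scheme \<Rightarrow> ('a, 'f, 'r, 'z) fo_struct_scheme \<Rightarrow> bool" where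
  "structural_reduct Mb M \<longleftrightarrow> carrier Mb = carrier M \<and>
     (\<forall>g\<in>ops Mb. is_term_function M (oar Mb g) (opn Mb g)) \<and>
     (\<forall>r\<in>rels Mb. conjunct_atomic_definable M (rar Mb r) (rln Mb r))"

definition Clo1 :: "('a, 'f, 'r, 'z) fo_struct_scheme \<Rightarrow> ('a \<Rightarrow> 'a) set" where
  "Clo1 A = {\<lambda>x\<in>carrier A. trm_val A [x] t | t. wf_trm (sig A) 1 t}"

definition comp_sets :: "('b \<Rightarrow> 'c) set \<Rightarrow> ('a \<Rightarrow> 'b) set \<Rightarrow> ('a \<Rightarrow> 'c) set" where
  "comp_sets \<Omega> E = {\<omega> \<circ> u | \<omega> u. \<omega> \<in> \<Omega> \<and> u \<in> E}"

definition separates_points :: "('a \<Rightarrow> 'b) set \<Rightarrow> 'a set \<Rightarrow> bool" where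
  "separates_points Z A \<longleftrightarrow> (\<forall>a\<in>A. \<forall>b\<in>A. a \<noteq> b \<longrightarrow> (\<exists>z\<in>Z. z a \<noteq> z b))"

definition separates_structure ::
  "('a \<Rightarrow> 'b) set \<Rightarrow> ('a, 'f, 'r, 'y) fo_struct_scheme \<Rightarrow> ('b, 'f, 'r, 'z) fo_struct_scheme \<Rightarrow> bool" where
  "separates_structure Z A N \<longleftrightarrow> separates_points Z (carrier A) \<and>
     (\<forall>r\<in>rels A. \<forall>xs\<in>tuples (carrier A) (rar A r). xs \<notin> rln A r \<longrightarrow>
        (\<exists>z\<in>Z. map z xs \<notin> rln N r))"

section \<open>Maximal relations and entailment\<close>

definition preimage_rel :: "'m set \<Rightarrow> ('m \<Rightarrow> 'n) list \<Rightarrow> 'n list set \<Rightarrow> 'm list set" where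
  "preimage_rel D \<omega>s r =
     {xs \<in> tuples D (length \<omega>s). map2 (\<lambda>\<omega> x. \<omega> x) \<omega>s xs \<in> r}"

definition diagonal :: "'n set \<Rightarrow> 'n list set" where
  "diagonal D = {[a, a] | a. a \<in> D}"

definition ker_rel :: "'m set \<Rightarrow> 'n set \<Rightarrow> ('m \<Rightarrow> 'n) \<Rightarrow> 'm list set" where
  "ker_rel D E \<omega> = preimage_rel D [\<omega>, \<omega>] (diagonal E)"

definition maximal_substructure ::
  "('m, 'f, 'r, 'z) fo_struct_scheme \<Rightarrow> nat \<Rightarrow> 'm list set \<Rightarrow> 'm list set \<Rightarrow> bool" where
  "maximal_substructure M n q s \<longleftrightarrow> forms_substructure M n s \<and> s \<subseteq> q \<and>
     (\<forall>s'. forms_substructure M n s' \<and> s' \<subseteq> q \<and> s \<subseteq> s' \<longrightarrow> s' = s)"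

definition max_rels ::
  "('m, 'f, 'r, 'z) fo_struct_scheme \<Rightarrow> ('m \<Rightarrow> 'n) set \<Rightarrow> nat \<Rightarrow> 'n list set \<Rightarrow> 'm list set set" where
  "max_rels M \<Omega> n r = {s. \<exists>\<omega>s. length \<omega>s = n \<and> set \<omega>s \<subseteq> \<Omega> \<and>
     maximal_substructure M n (preimage_rel (carrier M) \<omega>s r) s}"

definition entails ::
  "'a itself \<Rightarrow> ('m, 'f1, 'r1, 'y) fo_struct_scheme \<Rightarrow> ('m, 'f2, 'r2, 'z) fo_tstruct_scheme \<Rightarrow>
   nat \<Rightarrow> 'm list set \<Rightarrow> bool" where
  "entails T M Mt n s \<longleftrightarrow> forms_substructure M n s \<and>
     (\<forall>A :: ('a, 'f1, 'r1) fo_struct. in_ISP M A \<longrightarrow>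
        (\<forall>\<alpha>\<in>thoms (dualD M Mt A) Mt. \<forall>xs\<in>tuples (homs A M) n.
           (\<forall>a\<in>carrier A. map (\<lambda>x. x a) xs \<in> s) \<longrightarrow> map \<alpha> xs \<in> s))"

end

theory Submission
  imports Defs
begin

text \<open>
  Let \<open>\<alpha>\<close> be a morphism from the dual of \<open>A\<close> to \<open>Mt\<close>, and let \<open>Ab\<close> be the reduct of \<open>A\<close> defined
  by the terms and formulas that define \<open>Mb\<close> from \<open>M\<close>; it belongs to the class generated by \<open>N\<close>.
  The maps \<open>\<omega> \<circ> x\<close>, with \<open>\<omega> \<in> \<Omega>\<close> and \<open>x : A \<rightarrow> M\<close>, form a closed substructure \<open>E\<close> of the dual
  of \<open>Ab\<close>, and \<open>\<omega> \<circ> x \<mapsto> \<omega> (\<alpha> x)\<close> is a well-defined morphism on \<open>E\<close>: a tuple of homomorphisms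
  \<open>x\<close> spans a substructure of a power of \<open>M\<close>, which by Zorn's lemma lies in a maximal one inside the
  relevant preimage, and this one is entailed, hence preserved by \<open>\<alpha>\<close>.  Injectivity of \<open>Nt\<close> extends
  the morphism to the dual of \<open>Ab\<close>, where it is evaluation at some \<open>a\<close> since \<open>Nt\<close> dualises \<open>N\<close>.
  As \<open>\<alpha>\<close> commutes with the unary term functions of \<open>Mt\<close>, separation gives \<open>\<alpha> x = x a\<close>.
\<close>

subsection \<open>Homomorphisms and terms\<close>

lemma tuples_lift:
  assumes "ys \<in> tuples (k ` D) n"
  obtains xs where "ys = map k xs" "xs \<in> tuples D n"
proof
  show "ys = map k (map (inv_into D k) ys)"
    using assms by (auto simp: tuples_def f_inv_into_f subset_iff intro!: map_idI[symmetric])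
  show "map (inv_into D k) ys \<in> tuples D n"
    using assms by (auto simp: tuples_def inv_into_into subset_iff)
qed

lemma homsI:
  assumes "h \<in> extensional (carrier A)" "sig A = sig B"
    and "\<And>a. a \<in> carrier A \<Longrightarrow> h a \<in> carrier B"
    and "\<And>f xs. f \<in> ops A \<Longrightarrow> xs \<in> tuples (carrier A) (oar A f) \<Longrightarrow> h (opn A f xs) = opn B f (map h xs)"
    and "\<And>r xs. r \<in> rels A \<Longrightarrow> xs \<in> tuples (carrier A) (rar A r) \<Longrightarrow> xs \<in> rln A r \<Longrightarrow> map h xs \<in> rln B r"
  shows "h \<in> homs A B"
  using assms by (auto simp: homs_def is_hom_def)

lemma homsD:
  assumes "h \<in> homs A B"
  shows "h \<in> extensional (carrier A)" "sig A = sig B"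
    and "a \<in> carrier A \<Longrightarrow> h a \<in> carrier B"
    and "f \<in> ops A \<Longrightarrow> xs \<in> tuples (carrier A) (oar A f) \<Longrightarrow> h (opn A f xs) = opn B f (map h xs)"
    and "r \<in> rels A \<Longrightarrow> xs \<in> tuples (carrier A) (rar A r) \<Longrightarrow> xs \<in> rln A r \<Longrightarrow> map h xs \<in> rln B r"
  using assms by (auto simp: homs_def is_hom_def)

lemma homs_in_PiE: "h \<in> homs A B \<Longrightarrow> h \<in> (\<Pi>\<^sub>E a\<in>carrier A. carrier B)"
  by (auto simp: homs_def is_hom_def PiE_def)

lemma map_restrict_tuples:
  "xs \<in> tuples D n \<Longrightarrow> map (\<lambda>x\<in>D. f x) xs = map f xs"
  by (auto simp: tuples_def)

text \<open>\<open>compose\<close> is extensional, so it agrees with the plain composite only on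
  \<open>carrier A\<close>; \<open>is_struct A\<close> keeps the operation values there.\<close>

lemma homs_compose:
  assumes "g \<in> homs B C" "h \<in> homs A B" "is_struct A"
  shows "compose (carrier A) g h \<in> homs A C"
proof (rule homsI)
  have m: "map (compose (carrier A) g h) xs = map g (map h xs)" if "xs \<in> tuples (carrier A) n" for xs n
    using that by (auto simp: compose_def tuples_def)
  have t: "map h xs \<in> tuples (carrier B) n" if "xs \<in> tuples (carrier A) n" for xs n
    using that homsD(3)[OF assms(2)] by (auto intro: tuples_map)
  show "sig A = sig C" using homsD(2)[OF assms(1)] homsD(2)[OF assms(2)] by simp
  show "compose (carrier A) g h a \<in> carrier C" if "a \<in> carrier A" for a
    using that homsD(3)[OF assms(1)] homsD(3)[OF assms(2)] by (simp add: compose_def)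
  show "compose (carrier A) g h (opn A f xs) = opn C f (map (compose (carrier A) g h) xs)"
    if "f \<in> ops A" "xs \<in> tuples (carrier A) (oar A f)" for f xs
    using that assms(3) homsD(4)[OF assms(2) that] homsD(4)[OF assms(1), of f "map h xs"] t[OF that(2)]
      homsD(2)[OF assms(2)]
    by (simp add: m[OF that(2)] compose_eq is_struct_def)
  show "map (compose (carrier A) g h) xs \<in> rln C r"
    if "r \<in> rels A" "xs \<in> tuples (carrier A) (rar A r)" "xs \<in> rln A r" for r xs
    using that homsD(5)[OF assms(2) that] homsD(5)[OF assms(1), of r "map h xs"] t[OF that(2)]
      homsD(2)[OF assms(2)]
    by (simp only: m[OF that(2)])
qed (simp add: compose_def)

lemma trm_val_closed:
  assumes "is_struct A" "wf_trm (sig A) n t" "xs \<in> tuples (carrier A) n"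
  shows "trm_val A xs t \<in> carrier A"
  using assms(2)
proof (induction t)
  case (Var i)
  then show ?case using assms(3) by (auto simp: tuples_def)
next
  case (Fn f ts)
  then have "map (trm_val A xs) ts \<in> tuples (carrier A) (oar A f)"
    by (auto simp: tuples_def)
  then show ?case using Fn assms(1) by (auto simp: is_struct_def)
qed

lemma hom_trm_val:
  assumes "is_struct A" "is_hom A B h" "wf_trm (sig A) n t" "xs \<in> tuples (carrier A) n"
  shows "h (trm_val A xs t) = trm_val B (map h xs) t"
  using assms(3)
proof (induction t)
  case (Var i)
  then show ?case using assms(4) by (simp add: tuples_def)
next
  case (Fn f ts)
  have "map (trm_val A xs) ts \<in> tuples (carrier A) (oar A f)"
    using trm_val_closed[OF assms(1) _ assms(4)] Fn.prems by (auto simp: tuples_def)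
  moreover have "map h (map (trm_val A xs) ts) = map (trm_val B (map h xs)) ts"
    using Fn by auto
  ultimately show ?case using assms(2) Fn.prems
    by (simp add: is_hom_def del: map_map)
qed

text \<open>Atomic formulas pass forward along homomorphisms, since terms commute with them. For the
  converse a single homomorphism does not suffice in general; a separating family is used
  there.\<close>

lemma hom_satisfies:
  assumes "is_struct A" "is_hom A B h" "wf_atomic (sig A) n \<phi>" "xs \<in> tuples (carrier A) n"
    and "satisfies A xs \<phi>"
  shows "satisfies B (map h xs) \<phi>"
proof (cases \<phi>)
  case (Eq t u)
  then have "wf_trm (sig A) n t" "wf_trm (sig A) n u" "trm_val A xs t = trm_val A xs u"
    using assms(3,5) by simp_all
  then show ?thesis using Eq hom_trm_val[OF assms(1,2) _ assms(4), symmetric] by simp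
next
  case (Rel r ts)
  have "map (trm_val A xs) ts \<in> tuples (carrier A) (rar A r)"
    using trm_val_closed[OF assms(1) _ assms(4)] assms(3) Rel by (auto simp: tuples_def)
  moreover have "map h (map (trm_val A xs) ts) = map (trm_val B (map h xs)) ts"
    using hom_trm_val[OF assms(1,2) _ assms(4)] assms(3) Rel by auto
  moreover have "r \<in> rels A" "map (trm_val A xs) ts \<in> rln A r"
    using assms(3,5) Rel by simp_all
  ultimately have "map (trm_val B (map h xs)) ts \<in> rln B r"
    using assms(2) unfolding is_hom_def by metis
  then show ?thesis using Rel by simp
qed

subsection \<open>Members of the generated classes\<close>

text \<open>The coordinates of an embedding into a power are homomorphisms to \<open>M\<close> that
  already separate the structure. Together with \<open>in_ISP_I\<close> this gives a criterion for
  membership that mentions no power; it is applied below to reducts.\<close>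

lemma in_ISP_D:
  fixes M :: "('m, 'f, 'r, 'y) fo_struct_scheme" and A :: "('a, 'f, 'r, 'z) fo_struct_scheme"
  assumes "in_ISP M A"
  shows "is_struct A" "carrier A \<noteq> {}" "sig A = sig M" "separates_structure (homs A M) A M"
proof -
  obtain S :: "('a \<Rightarrow> 'm) set" and h D where A: "is_struct A" "carrier A \<noteq> {}"
    and D: "subuniverse (spower M S) D" and iso: "is_iso A (induced (spower M S) D) h"
    using assms unfolding in_ISP_def is_embedding_def substructure_def by blast
  note p = power_coords[OF A(1) D iso]
  show "is_struct A" "carrier A \<noteq> {}" "sig A = sig M" using A p(1) by auto
  show "separates_structure (homs A M) A M"
    unfolding separates_structure_def separates_points_def
  proof (intro conjI ballI impI)
    fix a b assume "a \<in> carrier A" "b \<in> carrier A" "a \<noteq> b"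
    then show "\<exists>z\<in>homs A M. z a \<noteq> z b" using p(2) p(3)[of a b] by blast
  next
    fix r xs assume "r \<in> rels A" "xs \<in> tuples (carrier A) (rar A r)" "xs \<notin> rln A r"
    then show "\<exists>z\<in>homs A M. map z xs \<notin> rln M r" using p(2) p(4)[of r xs] by blast
  qed
qed

text \<open>Evaluation is the canonical map into the power indexed by all homomorphisms. Separation
  of points makes it injective, and separation of relations makes its inverse a
  homomorphism.\<close>

lemma eval_iso:
  assumes "is_struct A" "sig A = sig M" "separates_structure (homs A M) A M"
  shows "subuniverse (spower M (homs A M)) (eval_e M A ` carrier A)"
    and "is_iso A (induced (spower M (homs A M)) (eval_e M A ` carrier A)) (eval_e M A)"
proof -
  have sep: "\<forall>a\<in>carrier A. \<forall>b\<in>carrier A. (\<forall>x\<in>homs A M. x a = x b) \<longrightarrow> a = b"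
    using assms(3) unfolding separates_structure_def separates_points_def by blast
  have refl: "\<forall>r\<in>rels A. \<forall>xs\<in>tuples (carrier A) (rar A r).
                (\<forall>x\<in>homs A M. map x xs \<in> rln M r) \<longrightarrow> xs \<in> rln A r"
    using assms(3) by (auto simp: separates_structure_def)
  have e: "eval_e M A = (\<lambda>a. \<lambda>x\<in>homs A M. x a)" by (simp add: fun_eq_iff eval_e_def)
  show "subuniverse (spower M (homs A M)) (eval_e M A ` carrier A)"
    and "is_iso A (induced (spower M (homs A M)) (eval_e M A ` carrier A)) (eval_e M A)"
    unfolding e by (fact canonical_map[OF assms(1,2) order_refl sep refl])+
qed

lemma in_ISP_I:
  assumes "is_struct A" "carrier A \<noteq> {}" "sig A = sig M" "separates_structure (homs A M) A M"
  shows "in_ISP M A"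
proof -
  have "is_embedding A (spower M (homs A M)) (eval_e M A)"
    unfolding is_embedding_def substructure_def
    using eval_iso[OF assms(1,3,4)] assms(2)
    by (intro exI[of _ "eval_e M A ` carrier A"]) (simp only: image_is_empty simp_thms)
  then show ?thesis
    using assms unfolding in_ISP_def by (intro conjI exI[of _ "homs A M"] exI[of _ "eval_e M A"])
qed

lemma is_struct_tinduced_tpower:
  assumes "closed_substructure (tpower M S) D"
  shows "is_struct (tinduced (tpower M S) D)"
  using assms unfolding is_struct_def closed_substructure_def subuniverse_def
  by (simp add: tuples_def subset_iff)

lemma is_tstruct_tinduced_tpower:
  assumes "closed_substructure (tpower M S) D"
  shows "is_tstruct (tinduced (tpower M S) D)"
  using is_struct_tinduced_tpower[OF assms] assms
    topspace_subtopology_subset[OF closedin_subset, of "tplgy (tpower M S)" D]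
  unfolding is_tstruct_def closed_substructure_def tinduced_simps by blast

lemma is_tiso_id: "is_tstruct X \<Longrightarrow> is_tiso X X (\<lambda>x. x)"
proof -
  \<comment> \<open>\<open>inv_into\<close> is only determined on \<open>D\<close>, so the inverse
    of the identity is computed on tuples and on elements of the carrier.\<close>
  have "map (inv_into D (\<lambda>x. x)) xs = xs" if "set xs \<subseteq> D" for D :: "'a set" and xs
    using that by (auto intro!: map_idI inv_into_f_eq)
  moreover have "inv_into D (\<lambda>x. x) x = x" if "x \<in> D" for D :: "'a set" and x
    using that by (auto intro!: inv_into_f_eq)
  ultimately show "is_tiso X X (\<lambda>x. x)" if "is_tstruct X"
    using that by (auto simp: is_tiso_def is_iso_def is_hom_def bij_betw_def tuples_def
      is_tstruct_def is_struct_def homeomorphic_map_id[unfolded id_def])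
qed

text \<open>The index set \<open>S\<close> may have any type here, whereas \<open>in_IScP\<close>
  asks for a set of maps; \<open>in_IScP_any_index\<close> bridges the two, with the inclusion as
  embedding.\<close>

lemma in_IScP_substructure:
  assumes "total_tstructure M" "S \<noteq> {}" "closed_substructure (tpower M S) D"
  shows "in_IScP M (tinduced (tpower M S) D)"
proof (rule in_IScP_any_index[OF assms(1) is_tstruct_tinduced_tpower[OF assms(3)] assms(2)])
  show "is_tembedding (tinduced (tpower M S) D) (tpower M S) (\<lambda>x. x)"
    using assms(3) is_tiso_id[OF is_tstruct_tinduced_tpower[OF assms(3)]]
    by (auto simp: is_tembedding_def)
qed

text \<open>This supplies the inclusion along which injectivity of \<open>Nt\<close> will extend a
  morphism from a closed substructure to a whole dual.\<close>

lemma is_tembedding_subset: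
  assumes "closed_substructure (tpower M S) D" "closed_substructure (tpower M S) E" "E \<subseteq> D"
  shows "is_tembedding (tinduced (tpower M S) E) (tinduced (tpower M S) D) (\<lambda>x. x)"
proof -
  let ?X = "tinduced (tpower M S) D" let ?Y = "tinduced (tpower M S) E"
  have "closed_substructure ?X E"
    using assms by (auto simp: closed_substructure_def subuniverse_def closedin_subtopology)
  moreover have "tinduced ?X E = ?Y"
    using assms(3) by (auto simp: tinduced_def subtopology_subtopology fun_eq_iff Int_absorb1)
  ultimately show ?thesis
    using is_tiso_id[OF is_tstruct_tinduced_tpower[OF assms(2)]]
    by (auto simp: is_tembedding_def)
qed

lemma coordinate_hom:
  assumes "s \<in> S" "D \<subseteq> (\<Pi>\<^sub>E s\<in>S. carrier M)"
  shows "is_hom (tinduced (tpower M S) D) M (\<lambda>x. x s)"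
  using assms by (auto simp: is_hom_def)

text \<open>For \<open>D = homs A M\<close> these restricted projections are the evaluations at
  points of \<open>A\<close>; this is the easy inclusion in a duality.\<close>

lemma coordinate_thoms:
  assumes "s \<in> S" "closed_substructure (tpower M S) D"
  shows "(\<lambda>x\<in>D. x s) \<in> thoms (tinduced (tpower M S) D) M"
proof -
  let ?X = "tinduced (tpower M S) D"
  have D: "D \<subseteq> (\<Pi>\<^sub>E s\<in>S. carrier M)"
    using assms by (auto simp: closed_substructure_def subuniverse_def)
  note h = coordinate_hom[OF assms(1) D]
  have "(\<lambda>x\<in>D. x s) \<in> homs ?X M"
    using h is_struct_tinduced_tpower[OF assms(2)]
    by (intro homsI) (auto simp: is_hom_def is_struct_def map_restrict_tuples simp del: spower_simps)
  moreover have "continuous_map (tplgy ?X) (tplgy M) (\<lambda>x\<in>D. x s)"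
  proof -
    have "continuous_map (tplgy ?X) (tplgy M) (\<lambda>x. x s)"
      using assms(1) by (auto intro!: continuous_map_from_subtopology continuous_map_product_projection)
    then show ?thesis by (rule continuous_map_eq) auto
  qed
  ultimately show ?thesis by (simp add: thoms_def)
qed

subsection \<open>Dual structures\<close>

lemma closedin_Collect_ball:
  assumes "\<And>i. i \<in> I \<Longrightarrow> closedin T {x \<in> topspace T. P i x}"
  shows "closedin T {x \<in> topspace T. \<forall>i\<in>I. P i x}"
\<comment> \<open>The set is an intersection of the given closed sets only when \<open>I\<close> is
  non-empty; otherwise it is the whole space.\<close>
proof (cases "I = {}")
  case False
  then have "{x \<in> topspace T. \<forall>i\<in>I. P i x} = (\<Inter>i\<in>I. {x \<in> topspace T. P i x})" by auto
  with False assms show ?thesis by (simp add: closedin_INT)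
qed auto

lemma alter_ego_D:
  assumes "alter_ego M Mt"
  shows "carrier Mt = carrier M"
    and "g \<in> ops Mt \<Longrightarrow> is_hom (fpower M (oar Mt g)) M (opn Mt g)"
    and "r \<in> rels M \<Longrightarrow> closedin (product_topology (\<lambda>i. tplgy Mt) {..<rar M r})
                            (tuple_fun (rar M r) ` rln M r)"
    and "f \<in> ops M \<Longrightarrow> continuous_map (product_topology (\<lambda>i. tplgy Mt) {..<oar M f}) (tplgy Mt)
                            (\<lambda>x. opn M f (map x [0..<oar M f]))"
  using assms unfolding alter_ego_def by blast+

lemma fpower_simps:
  "sig (fpower M n) = sig M" "carrier (fpower M n) = tuples (carrier M) n"
  "opn (fpower M n) f xs = map (\<lambda>i. opn M f (map (\<lambda>x. x ! i) xs)) [0..<n]"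
  "rln (fpower M n) r = {xs \<in> tuples (tuples (carrier M) n) (rar M r). \<forall>i<n. map (\<lambda>x. x ! i) xs \<in> rln M r}"
  by (simp_all add: fpower_def)

lemma homs_pointwise_tuple:
  assumes "xs \<in> tuples (homs A M) n" "a \<in> carrier A"
  shows "map (\<lambda>x. x a) xs \<in> tuples (carrier M) n"
  using assms homsD(3) by (fastforce simp: tuples_def)

text \<open>A tuple \<open>xs\<close> of homomorphisms induces the map from \<open>A\<close> to the
  \<open>n\<close>-th power of \<open>M\<close> that sends \<open>a\<close> to the tuple of values
  at \<open>a\<close>. This is its compatibility with operations.\<close>

lemma fpower_opn_homs:
  assumes "xs \<in> tuples (homs A M) n" "f \<in> ops A" "as \<in> tuples (carrier A) (oar A f)"
  shows "opn (fpower M n) f (map (\<lambda>a. map (\<lambda>x. x a) xs) as) = map (\<lambda>x. x (opn A f as)) xs"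
proof (rule nth_equalityI)
  fix i assume "i < length (opn (fpower M n) f (map (\<lambda>a. map (\<lambda>x. x a) xs) as))"
  then have i: "i < n" "i < length xs" "xs ! i \<in> homs A M"
    using assms(1) by (auto simp: fpower_simps tuples_def)
  then show "opn (fpower M n) f (map (\<lambda>a. map (\<lambda>x. x a) xs) as) ! i = map (\<lambda>x. x (opn A f as)) xs ! i"
    using homsD(4)[OF i(3) assms(2,3)] by (simp add: fpower_simps comp_def)
qed (use assms in \<open>simp add: fpower_simps tuples_def\<close>)

text \<open>An operation \<open>g\<close> of the alter ego is itself a homomorphism from a finite
  power of \<open>M\<close> to \<open>M\<close>. Composing it with the homomorphism from
  \<open>A\<close> into that power induced by \<open>xs\<close> yields a homomorphism again.\<close>

lemma subuniverse_homs:
  assumes "alter_ego M Mt" "is_struct A" "sig A = sig M"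
  shows "subuniverse (spower Mt (carrier A)) (homs A M)"
  unfolding subuniverse_def
proof (intro conjI ballI)
  show "homs A M \<subseteq> carrier (spower Mt (carrier A))"
    using homs_in_PiE[of _ A M] alter_ego_D(1)[OF assms(1)] by auto
  fix g xs assume "g \<in> ops (spower Mt (carrier A))" "xs \<in> tuples (homs A M) (oar (spower Mt (carrier A)) g)"
  then have g: "g \<in> ops Mt" and xs: "xs \<in> tuples (homs A M) (oar Mt g)" by simp_all
  let ?n = "oar Mt g" and ?h = "\<lambda>a\<in>carrier A. opn Mt g (map (\<lambda>x. x a) xs)"
  have hom: "is_hom (fpower M ?n) M (opn Mt g)" using alter_ego_D(2)[OF assms(1)] g .
  have t: "map (\<lambda>a. map (\<lambda>x. x a) xs) as \<in> tuples (tuples (carrier M) ?n) m"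
    if "as \<in> tuples (carrier A) m" for as m
    using that homs_pointwise_tuple[OF xs] by (intro tuples_map[of _ "carrier A"]) auto
  have "?h \<in> homs A M"
  proof (rule homsI)
    show "?h a \<in> carrier M" if "a \<in> carrier A" for a
      using that hom homs_pointwise_tuple[OF xs that] by (auto simp: is_hom_def fpower_simps)
  next
    fix f as assume f: "f \<in> ops A" and as: "as \<in> tuples (carrier A) (oar A f)"
    have "?h (opn A f as) = opn Mt g (map (\<lambda>x. x (opn A f as)) xs)"
      using assms(2) f as by (simp add: is_struct_def)
    also have "\<dots> = opn Mt g (opn (fpower M ?n) f (map (\<lambda>a. map (\<lambda>x. x a) xs) as))"
      using fpower_opn_homs[OF xs f as] by simp
    also have "\<dots> = opn M f (map (opn Mt g) (map (\<lambda>a. map (\<lambda>x. x a) xs) as))"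
      using hom f t[OF as] assms(3) by (simp add: is_hom_def fpower_simps(1,2) del: map_map)
    finally show "?h (opn A f as) = opn M f (map ?h as)"
      by (simp only: map_restrict_tuples[OF as] map_map comp_def)
  next
    fix r as assume r: "r \<in> rels A" and as: "as \<in> tuples (carrier A) (rar A r)" "as \<in> rln A r"
    have "map (\<lambda>y. y ! i) (map (\<lambda>a. map (\<lambda>x. x a) xs) as) \<in> rln M r" if "i < ?n" for i
    proof -
      have i: "i < length xs" "xs ! i \<in> homs A M" using that xs by (auto simp: tuples_def)
      show ?thesis using homsD(5)[OF i(2) r as] i(1) by (simp add: comp_def)
    qed
    then have "map (\<lambda>a. map (\<lambda>x. x a) xs) as \<in> rln (fpower M ?n) r"
      using t[OF as(1)] assms(3) by (simp add: fpower_simps(4) del: map_map)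
    then have "map (opn Mt g) (map (\<lambda>a. map (\<lambda>x. x a) xs) as) \<in> rln M r"
      using hom r t[OF as(1)] assms(3) by (simp add: is_hom_def fpower_simps(1,2) del: map_map)
    then show "map ?h as \<in> rln M r"
      by (simp only: map_restrict_tuples[OF as(1)] map_map comp_def)
  qed (use assms(3) in auto)
  then show "opn (spower Mt (carrier A)) g xs \<in> homs A M" by simp
qed

text \<open>Preserving an operation on a fixed tuple is an equality of two continuous maps into a
  Hausdorff space, and preserving a relation on a fixed tuple is a preimage of a closed set.
  \<open>homs A M\<close> is the intersection of all these conditions.\<close>

lemma closedin_homs:
  assumes "total_tstructure Mt" "alter_ego M Mt" "total_structure M" "is_struct A" "sig A = sig M"
  shows "closedin (product_topology (\<lambda>a. tplgy Mt) (carrier A)) (homs A M)"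
proof -
  let ?P = "product_topology (\<lambda>a. tplgy Mt) (carrier A)" and ?T = "tplgy Mt"
  note ae = alter_ego_D[OF assms(2)]
  have T: "Hausdorff_space ?T" "topspace ?T = carrier M"
    using assms(1) ae(1) by (auto simp: total_tstructure_def is_tstruct_def)
  let ?C = "{x \<in> topspace ?P. \<forall>f\<in>ops A. \<forall>as\<in>tuples (carrier A) (oar A f).
               x (opn A f as) = opn M f (map x as)}"
  let ?D = "{x \<in> topspace ?P. \<forall>r\<in>rels A. \<forall>as\<in>tuples (carrier A) (rar A r).
               as \<in> rln A r \<longrightarrow> map x as \<in> rln M r}"
  \<comment> \<open>Reading off the coordinates listed in \<open>as\<close> is continuous. It leads
    to the powers over \<open>{..<n}\<close> on which \<open>alter_ego\<close> states continuity and
    closedness.\<close>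
  have tup: "continuous_map ?P (product_topology (\<lambda>i. ?T) {..<n}) (\<lambda>x. \<lambda>i\<in>{..<n}. x (as ! i))"
    if "as \<in> tuples (carrier A) n" for as n
    using that unfolding continuous_map_componentwise
    by (auto simp: tuples_def subset_iff intro!: continuous_map_product_projection)
  have mt: "map (\<lambda>i\<in>{..<n}. x (as ! i)) [0..<n] = map x as" if "as \<in> tuples (carrier A) n" for as n x
    using that by (auto simp: tuples_def intro: nth_equalityI)
  have eqn: "homs A M = ?C \<inter> ?D"
  proof (intro equalityI subsetI)
    fix x assume x: "x \<in> homs A M"
    then show "x \<in> ?C \<inter> ?D" using homsD[OF x] homs_in_PiE[OF x] T(2) by auto
  next
    fix x assume "x \<in> ?C \<inter> ?D"
    then show "x \<in> homs A M" using assms(5) T(2) by (intro homsI) (auto simp: PiE_def)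
  qed
  have "closedin ?P ?C"
  proof (intro closedin_Collect_ball)
    fix f as assume f: "f \<in> ops A" and as: "as \<in> tuples (carrier A) (oar A f)"
    have "continuous_map ?P ?T ((\<lambda>x. opn M f (map x [0..<oar M f])) \<circ> (\<lambda>x. \<lambda>i\<in>{..<oar M f}. x (as ! i)))"
      using f as assms(5) by (intro continuous_map_compose[OF tup] ae(4)) auto
    then have "continuous_map ?P ?T (\<lambda>x. opn M f (map x as))"
      unfolding comp_def mt[OF as[unfolded assms(5)]] .
    moreover have "continuous_map ?P ?T (\<lambda>x. x (opn A f as))"
      using f as assms(4) by (intro continuous_map_product_projection) (simp add: is_struct_def)
    ultimately show "closedin ?P {x \<in> topspace ?P. x (opn A f as) = opn M f (map x as)}"
      using T(1) by (intro closedin_continuous_maps_eq)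
  qed
  moreover have "closedin ?P ?D"
  proof (intro closedin_Collect_ball)
    fix r as assume r: "r \<in> rels A" and as: "as \<in> tuples (carrier A) (rar A r)"
    have rel: "rln M r \<subseteq> tuples (carrier M) (rar M r)"
      using assms(3,5) r by (simp add: total_structure_def is_struct_def)
    \<comment> \<open>\<open>tuple_fun\<close> records only the first \<open>rar M r\<close>
      entries; the list can be recovered because \<open>rel\<close> fixes the length of every tuple
      in \<open>rln M r\<close>.\<close>
    have "(\<lambda>i\<in>{..<rar M r}. x (as ! i)) \<in> tuple_fun (rar M r) ` rln M r \<longleftrightarrow> map x as \<in> rln M r"
      for x
    proof
      assume "(\<lambda>i\<in>{..<rar M r}. x (as ! i)) \<in> tuple_fun (rar M r) ` rln M r"
      then obtain ys where ys: "ys \<in> rln M r" "(\<lambda>i\<in>{..<rar M r}. x (as ! i)) = tuple_fun (rar M r) ys"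
        by auto
      have "map x as = ys"
      proof (rule nth_equalityI)
        show "length (map x as) = length ys" using as ys(1) rel assms(5) by (auto simp: tuples_def)
        fix i assume "i < length (map x as)"
        then show "map x as ! i = ys ! i"
          using fun_cong[OF ys(2), of i] as assms(5) by (simp add: tuple_fun_def tuples_def)
      qed
      with ys(1) show "map x as \<in> rln M r" by simp
    next
      assume *: "map x as \<in> rln M r"
      have "(\<lambda>i\<in>{..<rar M r}. x (as ! i)) = tuple_fun (rar M r) (map x as)"
        using as assms(5) by (auto simp: tuple_fun_def tuples_def)
      then show "(\<lambda>i\<in>{..<rar M r}. x (as ! i)) \<in> tuple_fun (rar M r) ` rln M r" using * by simp
    qed
    then have "closedin ?P {x \<in> topspace ?P. map x as \<in> rln M r}"
      using closedin_continuous_map_preimage[OF tup ae(3), of as r] as r assms(5) by simp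
    then show "closedin ?P {x \<in> topspace ?P. as \<in> rln A r \<longrightarrow> map x as \<in> rln M r}"
      by (cases "as \<in> rln A r") (auto simp del: topspace_product_topology)
  qed
  ultimately show ?thesis unfolding eqn by (rule closedin_Int)
qed

lemma closed_substructure_homs:
  assumes "total_tstructure Mt" "alter_ego M Mt" "total_structure M" "is_struct A" "sig A = sig M"
  shows "closed_substructure (tpower Mt (carrier A)) (homs A M)"
  using subuniverse_homs[OF assms(2,4,5)] closedin_homs[OF assms]
  by (simp add: closed_substructure_def subuniverse_tpower)

text \<open>Since the homomorphisms to \<open>M\<close> separate \<open>A\<close>, evaluation is
  always an isomorphism onto its image, and evaluations are always morphisms. What remains of a
  duality is surjectivity.\<close>

lemma dualises_I:
  assumes "total_tstructure Mt" "alter_ego M Mt" "total_structure M"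
    and "\<And>(A :: ('a, 'f, 'r) fo_struct) \<alpha>. in_ISP M A \<Longrightarrow> \<alpha> \<in> thoms (dualD M Mt A) Mt \<Longrightarrow>
           \<exists>a\<in>carrier A. \<forall>x\<in>homs A M. \<alpha> x = x a"
  shows "dualises TYPE('a) M Mt"
  unfolding dualises_def
proof (intro allI impI)
  fix A :: "('a, 'f, 'r) fo_struct"
  assume A: "in_ISP M A"
  note A' = in_ISP_D[OF A]
  have "thoms (dualD M Mt A) Mt = eval_e M A ` carrier A"
  proof (intro equalityI subsetI)
    fix \<alpha> assume \<alpha>: "\<alpha> \<in> thoms (dualD M Mt A) Mt"
    then obtain a where a: "a \<in> carrier A" "\<forall>x\<in>homs A M. \<alpha> x = x a" using assms(4)[OF A] by blast
    have "\<alpha> \<in> extensional (homs A M)" using \<alpha> by (simp add: thoms_def homs_def dualD_def)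
    then have "\<alpha> = eval_e M A a"
      using a(2) by (auto simp: eval_e_def fun_eq_iff extensional_def)
    with a(1) show "\<alpha> \<in> eval_e M A ` carrier A" by blast
  next
    fix \<alpha> assume "\<alpha> \<in> eval_e M A ` carrier A"
    then show "\<alpha> \<in> thoms (dualD M Mt A) Mt"
      using coordinate_thoms[OF _ closed_substructure_homs[OF assms(1-3) A'(1,3)]]
      by (auto simp: eval_e_def dualD_def)
  qed
  then show "is_iso A (dualE M Mt (dualD M Mt A)) (eval_e M A)"
    using eval_iso(2)[OF A'(1,3,4)] by (simp add: dualE_def dualD_def)
qed

lemma dualises_D:
  assumes "dualises TYPE('a) M Mt" "in_ISP M (A :: ('a, 'f, 'r) fo_struct)" "\<beta> \<in> thoms (dualD M Mt A) Mt"
  obtains a where "a \<in> carrier A" "\<And>x. x \<in> homs A M \<Longrightarrow> \<beta> x = x a"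
proof -
  have "bij_betw (eval_e M A) (carrier A) (carrier (dualE M Mt (dualD M Mt A)))"
    using assms(1,2) by (simp add: dualises_def is_iso_def)
  then have "\<beta> \<in> eval_e M A ` carrier A"
    using assms(3) by (simp add: dualE_def bij_betw_def)
  then show thesis using that by (auto simp: eval_e_def)
qed

subsection \<open>Maximal substructures and entailment\<close>

lemma extend_to_maximal_substructure:
  assumes "forms_substructure M n s0" "s0 \<subseteq> q"
  shows "\<exists>s. s0 \<subseteq> s \<and> maximal_substructure M n q s"
proof -
  let ?F = "{s. forms_substructure M n s \<and> s0 \<subseteq> s \<and> s \<subseteq> q}"
  have "\<exists>s\<in>?F. \<forall>X\<in>?F. s \<subseteq> X \<longrightarrow> X = s"
  proof (rule subset_Zorn_nonempty)
    show "?F \<noteq> {}" using assms by blast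
    fix C assume C: "C \<noteq> {}" "subset.chain ?F C"
    then have CF: "C \<subseteq> ?F" by (simp add: subset.chain_def)
    have "opn (fpower M n) f xs \<in> \<Union>C" if f: "f \<in> ops (fpower M n)" "xs \<in> tuples (\<Union>C) (oar (fpower M n) f)" for f xs
    proof -
      \<comment> \<open>Operations are finitary, so the arguments already lie in one member of the
        chain; non-emptiness of \<open>C\<close> covers the empty list of a nullary
        operation.\<close>
      obtain s where s: "s \<in> C" "set xs \<subseteq> s"
        using finite_subset_Union_chain[OF _ _ C, of "set xs"] f(2) by (auto simp: tuples_def)
      have "opn (fpower M n) f xs \<in> s"
        using s f CF by (auto simp: forms_substructure_def substructure_def subuniverse_def tuples_def)
      with s(1) show ?thesis by blast
    qed
    moreover obtain s1 where "s1 \<in> C" using C(1) by blast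
    then have "\<Union>C \<noteq> {}" "s0 \<subseteq> \<Union>C"
      using CF unfolding forms_substructure_def substructure_def by blast+
    moreover have "\<Union>C \<subseteq> carrier (fpower M n)" "\<Union>C \<subseteq> q"
      using CF unfolding forms_substructure_def substructure_def subuniverse_def by blast+
    ultimately show "\<Union>C \<in> ?F" by (simp add: forms_substructure_def substructure_def subuniverse_def)
  qed
  then obtain s where s: "forms_substructure M n s" "s0 \<subseteq> s" "s \<subseteq> q"
    and max: "\<And>X. X \<in> ?F \<Longrightarrow> s \<subseteq> X \<Longrightarrow> X = s"
    by auto
  have "maximal_substructure M n q s"
    unfolding maximal_substructure_def
  proof (intro conjI allI impI)
    fix s' assume "forms_substructure M n s' \<and> s' \<subseteq> q \<and> s \<subseteq> s'"
    then show "s' = s" using s(2) by (intro max) auto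
  qed (use s in auto)
  with s(2) show ?thesis by blast
qed

text \<open>This set is the image of the homomorphism from \<open>A\<close> to the
  \<open>n\<close>-th power induced by \<open>xs\<close>.\<close>

lemma forms_substructure_image:
  assumes "is_struct A" "carrier A \<noteq> {}" "sig A = sig M" "xs \<in> tuples (homs A M) n"
  shows "forms_substructure M n ((\<lambda>a. map (\<lambda>x. x a) xs) ` carrier A)"
  unfolding forms_substructure_def substructure_def subuniverse_def
proof (intro conjI ballI)
  let ?k = "\<lambda>a. map (\<lambda>x. x a) xs"
  show "?k ` carrier A \<subseteq> carrier (fpower M n)"
    using homs_pointwise_tuple[OF assms(4)] by (auto simp: fpower_simps)
  fix f ys assume f: "f \<in> ops (fpower M n)" "ys \<in> tuples (?k ` carrier A) (oar (fpower M n) f)"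
  then obtain as where as: "ys = map ?k as" "as \<in> tuples (carrier A) (oar A f)"
    using assms(3) by (auto simp: fpower_simps elim!: tuples_lift)
  have "f \<in> ops A" using f(1) assms(3) by (simp add: fpower_simps)
  then show "opn (fpower M n) f ys \<in> ?k ` carrier A"
    using fpower_opn_homs[OF assms(4) _ as(2)] assms(1) as by (auto simp: is_struct_def)
qed (use assms(2) in auto)

text \<open>The preimage of \<open>r\<close> need not be closed under the operations of
  \<open>M\<close>, so it cannot be entailed directly. The image of \<open>A\<close> under
  \<open>xs\<close> is a substructure inside it, hence lies in a maximal one; that one is entailed,
  so it contains \<open>map \<alpha> xs\<close> and keeps this tuple in the preimage.\<close>

lemma entailed_max_rels_preserved:
  fixes A :: "('a, 'f, 'r) fo_struct"
  assumes ent: "\<forall>s\<in>max_rels M \<Omega> n r. entails TYPE('a) M Mt n s"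
    and A: "in_ISP M A" and \<alpha>: "\<alpha> \<in> thoms (dualD M Mt A) Mt"
    and xs: "xs \<in> tuples (homs A M) n" and \<omega>s: "length \<omega>s = n" "set \<omega>s \<subseteq> \<Omega>"
    and pre: "\<And>a. a \<in> carrier A \<Longrightarrow> map2 (\<lambda>\<omega> x. \<omega> x) \<omega>s (map (\<lambda>x. x a) xs) \<in> r"
  shows "map2 (\<lambda>\<omega> x. \<omega> x) \<omega>s (map \<alpha> xs) \<in> r"
proof -
  note A' = in_ISP_D[OF A]
  let ?s = "(\<lambda>a. map (\<lambda>x. x a) xs) ` carrier A" and ?q = "preimage_rel (carrier M) \<omega>s r"
  have "?s \<subseteq> ?q"
    using pre homs_pointwise_tuple[OF xs] \<omega>s(1) by (auto simp: preimage_rel_def)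
  then obtain s where s: "?s \<subseteq> s" "maximal_substructure M n ?q s"
    using extend_to_maximal_substructure[OF forms_substructure_image[OF A'(1-3) xs]] by metis
  then have "s \<in> max_rels M \<Omega> n r" using \<omega>s by (auto simp: max_rels_def)
  then have "entails TYPE('a) M Mt n s" using ent by blast
  then have "map \<alpha> xs \<in> s"
    unfolding entails_def using A \<alpha> xs s(1) by (simp add: image_subset_iff)
  then show ?thesis using s(2) by (auto simp: maximal_substructure_def preimage_rel_def)
qed

subsection \<open>Structural reducts\<close>

lemma separates_structureD:
  assumes "separates_structure Z A N"
  shows "a \<in> carrier A \<Longrightarrow> b \<in> carrier A \<Longrightarrow> a \<noteq> b \<Longrightarrow> \<exists>z\<in>Z. z a \<noteq> z b"
    and "r \<in> rels A \<Longrightarrow> xs \<in> tuples (carrier A) (rar A r) \<Longrightarrow> xs \<notin> rln A r \<Longrightarrow>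
           \<exists>z\<in>Z. map z xs \<notin> rln N r"
  using assms unfolding separates_structure_def separates_points_def by blast+

text \<open>Membership of the reduct is shown by separation in two stages: what differs or fails in
  \<open>A\<close> is detected by some homomorphism to \<open>M\<close>, and then, inside
  \<open>Mb\<close>, by some homomorphism to \<open>N\<close>. The composites of the two are
  homomorphisms on the reduct.\<close>

lemma structural_reduct_of_member:
  fixes M :: "('m, 'f1, 'r1) fo_struct" and Mb :: "('m, 'f3, 'r3) fo_struct"
    and N :: "('n, 'f3, 'r3) fo_struct" and A :: "('c, 'f1, 'r1) fo_struct"
  assumes red: "structural_reduct Mb M" and Mb: "in_ISP N Mb" and A: "in_ISP M A"
  obtains Ab :: "('c, 'f3, 'r3) fo_struct" where "in_ISP N Ab" "carrier Ab = carrier A"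
    "\<And>x. x \<in> homs A M \<Longrightarrow> x \<in> homs Ab Mb"
proof -
  note A' = in_ISP_D[OF A] and Mb' = in_ISP_D[OF Mb]
  have cM: "carrier Mb = carrier M" using red by (simp add: structural_reduct_def)
  obtain t where t: "\<And>g. g \<in> ops Mb \<Longrightarrow> wf_trm (sig M) (oar Mb g) (t g)"
    "\<And>g xs. g \<in> ops Mb \<Longrightarrow> xs \<in> tuples (carrier M) (oar Mb g) \<Longrightarrow> opn Mb g xs = trm_val M xs (t g)"
  proof -
    have "\<forall>g\<in>ops Mb. \<exists>t. wf_trm (sig M) (oar Mb g) t \<and>
        (\<forall>xs\<in>tuples (carrier M) (oar Mb g). opn Mb g xs = trm_val M xs t)"
      using red by (simp add: structural_reduct_def is_term_function_def)
    from bchoice[OF this] obtain t where "\<forall>g\<in>ops Mb. wf_trm (sig M) (oar Mb g) (t g) \<and>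
        (\<forall>xs\<in>tuples (carrier M) (oar Mb g). opn Mb g xs = trm_val M xs (t g))" ..
    then show thesis by (intro that[of t]) simp_all
  qed
  obtain \<Phi> where wf: "\<And>r \<phi>. r \<in> rels Mb \<Longrightarrow> \<phi> \<in> \<Phi> r \<Longrightarrow> wf_atomic (sig M) (rar Mb r) \<phi>"
    and rln: "\<And>r. r \<in> rels Mb \<Longrightarrow>
      rln Mb r = {xs \<in> tuples (carrier M) (rar Mb r). \<forall>\<phi>\<in>\<Phi> r. satisfies M xs \<phi>}"
  proof -
    have "\<forall>r\<in>rels Mb. \<exists>\<Phi>. (\<forall>\<phi>\<in>\<Phi>. wf_atomic (sig M) (rar Mb r) \<phi>) \<and>
        rln Mb r = {xs \<in> tuples (carrier M) (rar Mb r). \<forall>\<phi>\<in>\<Phi>. satisfies M xs \<phi>}"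
      using red unfolding structural_reduct_def conjunct_atomic_definable_def by blast
    from bchoice[OF this] obtain \<Phi> where "\<forall>r\<in>rels Mb. (\<forall>\<phi>\<in>\<Phi> r. wf_atomic (sig M) (rar Mb r) \<phi>) \<and>
        rln Mb r = {xs \<in> tuples (carrier M) (rar Mb r). \<forall>\<phi>\<in>\<Phi> r. satisfies M xs \<phi>}" ..
    then show thesis by (intro that[of \<Phi>]) blast+
  qed
  \<comment> \<open>Each symbol is interpreted in \<open>A\<close> by the term or the formulas
    chosen for it in \<open>M\<close>; hence homomorphisms from \<open>A\<close> to \<open>M\<close>
    become homomorphisms to \<open>Mb\<close>.\<close>
  define Ab :: "('c, 'f3, 'r3) fo_struct" where
    "Ab = \<lparr>sig = sig Mb, carrier = carrier A, opn = (\<lambda>g xs. trm_val A xs (t g)),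
       rln = (\<lambda>r. {xs \<in> tuples (carrier A) (rar Mb r). \<forall>\<phi>\<in>\<Phi> r. satisfies A xs \<phi>})\<rparr>"
  have Ab: "sig Ab = sig Mb" "carrier Ab = carrier A" "opn Ab g xs = trm_val A xs (t g)"
    "rln Ab r = {xs \<in> tuples (carrier A) (rar Mb r). \<forall>\<phi>\<in>\<Phi> r. satisfies A xs \<phi>}" for g xs r
    by (simp_all add: Ab_def)
  have map_t: "map x xs \<in> tuples (carrier M) n" if "x \<in> homs A M" "xs \<in> tuples (carrier A) n" for x xs n
    using that homsD(3)[OF that(1)] by (auto intro: tuples_map)
  have hom: "is_hom A M x" if "x \<in> homs A M" for x using that by (simp add: homs_def)
  have hb: "x \<in> homs Ab Mb" if x: "x \<in> homs A M" for x
  proof (rule homsI)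
    show "x \<in> extensional (carrier Ab)" using homsD(1)[OF x] Ab by simp
    show "x a \<in> carrier Mb" if "a \<in> carrier Ab" for a using homsD(3)[OF x] that Ab cM by simp
    show "x (opn Ab g xs) = opn Mb g (map x xs)"
      if "g \<in> ops Ab" "xs \<in> tuples (carrier Ab) (oar Ab g)" for g xs
      using hom_trm_val[OF A'(1) hom[OF x], of "oar Mb g" "t g" xs] t[of g] that map_t[OF x] A'(3) Ab
      by simp
    show "map x xs \<in> rln Mb r"
      if "r \<in> rels Ab" "xs \<in> tuples (carrier Ab) (rar Ab r)" "xs \<in> rln Ab r" for r xs
    proof -
      have r: "r \<in> rels Mb" and xs: "xs \<in> tuples (carrier A) (rar Mb r)"
        and sat: "\<And>\<phi>. \<phi> \<in> \<Phi> r \<Longrightarrow> satisfies A xs \<phi>"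
        using that Ab by auto
      have "satisfies M (map x xs) \<phi>" if "\<phi> \<in> \<Phi> r" for \<phi>
        using hom_satisfies[OF A'(1) hom[OF x] _ xs sat[OF that]] wf[OF r that] A'(3) by simp
      then show ?thesis using rln[OF r] map_t[OF x xs] by simp
    qed
  qed (simp add: Ab)
  have sAb: "is_struct Ab"
    unfolding is_struct_def
    using trm_val_closed[OF A'(1)] t(1) A'(3) by (auto simp: Ab)
  note sep = separates_structureD[OF A'(4)] and sepb = separates_structureD[OF Mb'(4)]
  have comp: "compose (carrier A) y x \<in> homs Ab N" if "x \<in> homs A M" "y \<in> homs Mb N" for x y
    using homs_compose[OF that(2) hb[OF that(1)] sAb] Ab(2) by simp
  have compm: "map (compose (carrier A) y x) xs = map y (map x xs)" if "xs \<in> tuples (carrier A) n"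
    for x y xs n
    using that by (auto simp: compose_def tuples_def)
  have "separates_structure (homs Ab N) Ab N"
    unfolding separates_structure_def separates_points_def
  proof (intro conjI ballI impI)
    fix a b assume ab: "a \<in> carrier Ab" "b \<in> carrier Ab" "a \<noteq> b"
    then obtain x where x: "x \<in> homs A M" "x a \<noteq> x b" using sep(1)[of a b] Ab(2) by auto
    then have "x a \<in> carrier Mb" "x b \<in> carrier Mb" using homsD(3)[OF x(1)] ab cM Ab(2) by auto
    then obtain y where "y \<in> homs Mb N" "y (x a) \<noteq> y (x b)" using sepb(1) x(2) by blast
    then show "\<exists>z\<in>homs Ab N. z a \<noteq> z b"
      using comp[OF x(1)] ab Ab(2) by (intro bexI[of _ "compose (carrier A) y x"]) (auto simp: compose_def)
  next
    fix r xs assume r: "r \<in> rels Ab" and xs: "xs \<in> tuples (carrier Ab) (rar Ab r)" "xs \<notin> rln Ab r"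
    have xs': "xs \<in> tuples (carrier A) (rar Mb r)" and r': "r \<in> rels Mb" using xs(1) r Ab by simp_all
    obtain \<phi> where \<phi>: "\<phi> \<in> \<Phi> r" "\<not> satisfies A xs \<phi>" using xs Ab by auto
    have wf\<phi>: "wf_atomic (sig A) (rar Mb r) \<phi>" using wf[OF r' \<phi>(1)] A'(3) by simp
    \<comment> \<open>A failing equation is refuted in \<open>M\<close> by separating the values of
      its two sides, a failing relational atom by separating its tuple of term values from the
      relation.\<close>
    have "\<exists>x\<in>homs A M. \<not> satisfies M (map x xs) \<phi>"
    proof (cases \<phi>)
      case (Eq u v)
      then have uv: "wf_trm (sig A) (rar Mb r) u" "wf_trm (sig A) (rar Mb r) v"
        "trm_val A xs u \<noteq> trm_val A xs v"
        using wf\<phi> \<phi>(2) by auto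
      then obtain x where x: "x \<in> homs A M" "x (trm_val A xs u) \<noteq> x (trm_val A xs v)"
        using sep(1) trm_val_closed[OF A'(1) _ xs'] by blast
      then have "\<not> satisfies M (map x xs) \<phi>"
        using Eq uv hom_trm_val[OF A'(1) hom[OF x(1)] _ xs'] by simp
      with x(1) show ?thesis by blast
    next
      case (Rel q ts)
      then have ts: "q \<in> rels A" "map (trm_val A xs) ts \<in> tuples (carrier A) (rar A q)"
        "map (trm_val A xs) ts \<notin> rln A q" "\<And>u. u \<in> set ts \<Longrightarrow> wf_trm (sig A) (rar Mb r) u"
        using wf\<phi> \<phi>(2) trm_val_closed[OF A'(1) _ xs'] by (auto simp: tuples_def)
      then obtain x where x: "x \<in> homs A M" "map x (map (trm_val A xs) ts) \<notin> rln M q"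
        using sep(2) by blast
      moreover have "map x (map (trm_val A xs) ts) = map (trm_val M (map x xs)) ts"
        using hom_trm_val[OF A'(1) hom[OF x(1)] _ xs'] ts(4) by auto
      ultimately have "map (trm_val M (map x xs)) ts \<notin> rln M q" by metis
      then have "\<not> satisfies M (map x xs) \<phi>" using Rel by simp
      with x(1) show ?thesis by blast
    qed
    then obtain x where x: "x \<in> homs A M" "\<not> satisfies M (map x xs) \<phi>" by blast
    have "map x xs \<notin> rln Mb r" using x(2) rln[OF r'] \<phi>(1) by blast
    moreover have "map x xs \<in> tuples (carrier Mb) (rar Mb r)" using map_t[OF x(1) xs'] cM by simp
    ultimately obtain y where "y \<in> homs Mb N" "map y (map x xs) \<notin> rln N r" using sepb(2)[OF r'] by blast
    then show "\<exists>z\<in>homs Ab N. map z xs \<notin> rln N r"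
      using comp[OF x(1)]
      by (intro bexI[of _ "compose (carrier A) y x"]) (simp_all add: compm[OF xs'] del: map_map)
  qed
  then have "in_ISP N Ab"
    using sAb A'(2) Ab(1,2) Mb'(3) by (intro in_ISP_I) simp_all
  with hb Ab(2) that show thesis by blast
qed

text \<open>The witness is the value of \<open>t\<close> in the dual at \<open>xs\<close>. Both
  \<open>\<alpha>\<close> and the projections to points of \<open>A\<close> are homomorphisms from
  the dual to \<open>Mt\<close>, so both commute with \<open>t\<close>.\<close>

lemma dual_term:
  assumes X: "closed_substructure (tpower Mt (carrier A)) (homs A M)"
    and \<alpha>: "\<alpha> \<in> thoms (dualD M Mt A) Mt"
    and t: "wf_trm (sig Mt) n t" and xs: "xs \<in> tuples (homs A M) n"
  shows "\<exists>x\<in>homs A M. (\<forall>a\<in>carrier A. x a = trm_val Mt (map (\<lambda>x. x a) xs) t) \<and>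
           \<alpha> x = trm_val Mt (map \<alpha> xs) t"
proof -
  let ?X = "dualD M Mt A"
  have sX: "is_struct ?X" and D: "homs A M \<subseteq> (\<Pi>\<^sub>E a\<in>carrier A. carrier Mt)"
    using is_struct_tinduced_tpower[OF X] X
    by (simp_all add: dualD_def closed_substructure_def subuniverse_def)
  have t': "wf_trm (sig ?X) n t" and xs': "xs \<in> tuples (carrier ?X) n"
    using t xs by (simp_all add: dualD_def)
  have "is_hom ?X Mt (\<lambda>x. x a)" if "a \<in> carrier A" for a
    using coordinate_hom[OF that D] by (simp add: dualD_def)
  moreover have "is_hom ?X Mt \<alpha>" using \<alpha> by (simp add: thoms_def homs_def)
  ultimately show ?thesis
    using trm_val_closed[OF sX t' xs'] hom_trm_val[OF sX _ t' xs']
    by (intro bexI[of _ "trm_val ?X xs t"]) (auto simp: dualD_def)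
qed

text \<open>Through \<open>\<omega>\<close> the operation \<open>g\<close> of \<open>Nt\<close>
  corresponds to \<open>g\<close> on the reduct \<open>Mtb\<close>, which is given by a term of
  \<open>Mt\<close>. By \<open>dual_term\<close> that term acts on homomorphisms and commutes with
  \<open>\<alpha>\<close>, so composites with a fixed \<open>\<omega>\<close> are closed under
  \<open>g\<close>.\<close>

lemma reduct_opn_compose:
  assumes X: "closed_substructure (tpower Mt (carrier A)) (homs A M)"
    and \<alpha>: "\<alpha> \<in> thoms (dualD M Mt A) Mt"
    and red: "structural_reduct Mtb Mt" and \<omega>: "\<omega> \<in> homs Mtb Nt"
    and g: "g \<in> ops Nt" and xs: "xs \<in> tuples (homs A M) (oar Nt g)"
  shows "\<exists>x\<in>homs A M. opn (spower Nt (carrier A)) g (map (compose (carrier A) \<omega>) xs) =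
           compose (carrier A) \<omega> x \<and> \<omega> (\<alpha> x) = opn Nt g (map \<omega> (map \<alpha> xs))"
proof -
  have g': "g \<in> ops Mtb" and ar: "oar Mtb g = oar Nt g" using g homsD(2)[OF \<omega>] by simp_all
  then obtain t where t: "wf_trm (sig Mt) (oar Nt g) t"
    "\<And>ys. ys \<in> tuples (carrier Mt) (oar Nt g) \<Longrightarrow> opn Mtb g ys = trm_val Mt ys t"
    using red by (auto simp: structural_reduct_def is_term_function_def)
  have cMt: "carrier Mtb = carrier Mt" using red by (simp add: structural_reduct_def)
  have op: "\<omega> (trm_val Mt ys t) = opn Nt g (map \<omega> ys)" if "ys \<in> tuples (carrier Mt) (oar Nt g)" for ys
    using homsD(4)[OF \<omega> g', of ys] t(2)[OF that] that ar cMt by simp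
  obtain x where x: "x \<in> homs A M" "\<And>a. a \<in> carrier A \<Longrightarrow> x a = trm_val Mt (map (\<lambda>x. x a) xs) t"
    "\<alpha> x = trm_val Mt (map \<alpha> xs) t"
    using dual_term[OF X \<alpha> t(1) xs] by blast
  have D: "homs A M \<subseteq> (\<Pi>\<^sub>E a\<in>carrier A. carrier Mt)"
    using X by (simp add: closed_substructure_def subuniverse_def)
  have "map (\<lambda>x. x a) xs \<in> tuples (carrier Mt) (oar Nt g)" if "a \<in> carrier A" for a
    using xs D that by (intro tuples_map[OF _ xs]) auto
  moreover have "map (\<lambda>z. z a) (map (compose (carrier A) \<omega>) xs) = map \<omega> (map (\<lambda>x. x a) xs)"
    if "a \<in> carrier A" for a
    using that by (simp add: compose_def)
  ultimately have "opn (spower Nt (carrier A)) g (map (compose (carrier A) \<omega>) xs) = compose (carrier A) \<omega> x"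
    using op x(2) by (auto simp: compose_def fun_eq_iff simp del: map_map)
  moreover have "\<omega> (\<alpha> x) = opn Nt g (map \<omega> (map \<alpha> xs))"
  proof -
    have "\<alpha> ` homs A M \<subseteq> carrier Mt"
      using \<alpha> by (auto simp: thoms_def homs_def is_hom_def dualD_def)
    from op[OF tuples_map[OF this xs]] show ?thesis by (simp only: x(3))
  qed
  ultimately show ?thesis using x(1) by blast
qed

subsection \<open>The piggyback argument\<close>

text \<open>The hypotheses \<open>wd\<close> and \<open>op\<close> isolate what the two alternatives
  of the theorem secure in different ways, so that one construction of the extension serves
  both.\<close>

lemma piggyback_extension:
  fixes M :: "('m, 'f1, 'r1) fo_struct" and Mt :: "('m, 'f2, 'r2) fo_tstruct"
    and N :: "('n, 'f3, 'r3) fo_struct" and Nt :: "('n, 'f4, 'r4) fo_tstruct"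
    and A :: "('c, 'f1, 'r1) fo_struct" and Ab :: "('c, 'f3, 'r3) fo_struct"
    and \<Omega> :: "('m \<Rightarrow> 'n) set"
  assumes M: "total_structure M" "total_tstructure Mt" "alter_ego M Mt"
    and N: "total_structure N" "total_tstructure Nt" "alter_ego N Nt"
    and inj: "injective_in_IScP TYPE('c \<Rightarrow> 'n) Nt"
    and A: "in_ISP M A" and Ab: "in_ISP N Ab" "carrier Ab = carrier A"
    and comp: "\<And>\<omega> x. \<omega> \<in> \<Omega> \<Longrightarrow> x \<in> homs A M \<Longrightarrow> compose (carrier A) \<omega> x \<in> homs Ab N"
    and \<alpha>: "\<alpha> \<in> thoms (dualD M Mt A) Mt"
    and fin: "finite \<Omega>" and cont: "\<And>\<omega>. \<omega> \<in> \<Omega> \<Longrightarrow> continuous_map (tplgy Mt) (tplgy Nt) \<omega>"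
    and wd: "\<And>\<omega> \<omega>' x y. \<omega> \<in> \<Omega> \<Longrightarrow> \<omega>' \<in> \<Omega> \<Longrightarrow> x \<in> homs A M \<Longrightarrow> y \<in> homs A M \<Longrightarrow>
      compose (carrier A) \<omega> x = compose (carrier A) \<omega>' y \<Longrightarrow> \<omega> (\<alpha> x) = \<omega>' (\<alpha> y)"
    and rel: "\<And>r. r \<in> rels Nt \<Longrightarrow>
      \<forall>s\<in>max_rels M \<Omega> (rar Nt r) (rln Nt r). entails TYPE('c) M Mt (rar Nt r) s"
    and op: "\<And>g zs. g \<in> ops Nt \<Longrightarrow>
      zs \<in> tuples (\<Union>\<omega>\<in>\<Omega>. compose (carrier A) \<omega> ` homs A M) (oar Nt g) \<Longrightarrow>
      \<exists>\<omega>\<in>\<Omega>. \<exists>xs\<in>tuples (homs A M) (oar Nt g). \<exists>x\<in>homs A M.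
        zs = map (compose (carrier A) \<omega>) xs \<and>
        opn (spower Nt (carrier A)) g zs = compose (carrier A) \<omega> x \<and>
        \<omega> (\<alpha> x) = opn Nt g (map \<omega> (map \<alpha> xs))"
  shows "\<exists>\<beta>\<in>thoms (dualD N Nt Ab) Nt. \<forall>\<omega>\<in>\<Omega>. \<forall>x\<in>homs A M.
    \<beta> (compose (carrier A) \<omega> x) = \<omega> (\<alpha> x)"
proof -
  note A' = in_ISP_D[OF A] and Ab' = in_ISP_D[OF Ab(1)]
  let ?c = "compose (carrier A)" and ?X = "homs A M"
  let ?PM = "product_topology (\<lambda>a. tplgy Mt) (carrier A)"
    and ?PN = "product_topology (\<lambda>a. tplgy Nt) (carrier A)"
  define E where "E = (\<Union>\<omega>\<in>\<Omega>. ?c \<omega> ` ?X)"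
  have EI: "?c \<omega> x \<in> E" if "\<omega> \<in> \<Omega>" "x \<in> ?X" for \<omega> x
    using that by (auto simp: E_def)
  have X: "closed_substructure (tpower Mt (carrier A)) ?X"
    using closed_substructure_homs[OF M(2,3,1) A'(1,3)] .
  have D: "closed_substructure (tpower Nt (carrier A)) (homs Ab N)"
    using closed_substructure_homs[OF N(2,3,1) Ab'(1,3)] Ab(2) by simp
  have ED: "E \<subseteq> homs Ab N" using comp by (auto simp: E_def)
  have DP: "homs Ab N \<subseteq> (\<Pi>\<^sub>E a\<in>carrier A. carrier Nt)"
    using D by (simp add: closed_substructure_def subuniverse_def)
  have "\<exists>\<omega> x. \<omega> \<in> \<Omega> \<and> x \<in> ?X \<and> z = ?c \<omega> x" if "z \<in> E" for z
    using that by (auto simp: E_def)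
  \<comment> \<open>An element of \<open>E\<close> may be a composite in several ways;
    \<open>w\<close> and \<open>p\<close> select one, and \<open>wd\<close> makes the value of
    \<open>\<gamma>\<close> below independent of the selection.\<close>
  then obtain w p where wp: "\<And>z. z \<in> E \<Longrightarrow> w z \<in> \<Omega>" "\<And>z. z \<in> E \<Longrightarrow> p z \<in> ?X"
    "\<And>z. z \<in> E \<Longrightarrow> z = ?c (w z) (p z)"
    by metis
  define \<gamma> where "\<gamma> = (\<lambda>z\<in>E. w z (\<alpha> (p z)))"
  have \<gamma>: "\<gamma> (?c \<omega> x) = \<omega> (\<alpha> x)" if "\<omega> \<in> \<Omega>" "x \<in> ?X" for \<omega> x
  proof -
    note z = EI[OF that]
    show ?thesis
      using wd[OF wp(1)[OF z] that(1) wp(2)[OF z] that(2) wp(3)[OF z, symmetric]] z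
      by (simp add: \<gamma>_def)
  qed
  have \<alpha>X: "\<alpha> x \<in> carrier Mt" if "x \<in> ?X" for x
    using \<alpha> that by (auto simp: thoms_def homs_def is_hom_def dualD_def)
  have \<alpha>c: "continuous_map (subtopology ?PM ?X) (tplgy Mt) \<alpha>"
    using \<alpha> by (simp add: thoms_def dualD_def)
  have tM: "topspace (tplgy Mt) = carrier Mt" "compact_space (tplgy Mt)"
    and tN: "topspace (tplgy Nt) = carrier Nt" "Hausdorff_space (tplgy Nt)"
    using M(2) N(2) by (auto simp: total_tstructure_def is_tstruct_def)
  have hP: "Hausdorff_space ?PN" using tN by (simp add: Hausdorff_space_product_topology)
  have cX: "compact_space (subtopology ?PM ?X)"
  proof -
    have "compact_space ?PM" using tM by (simp add: compact_space_product_topology)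
    moreover have "closedin ?PM ?X" using X by (simp add: closed_substructure_def)
    ultimately show ?thesis by (simp add: closedin_compact_space compact_space_subtopology)
  qed
  have topX: "topspace (subtopology ?PM ?X) = ?X"
    using X closedin_subset[of ?PM ?X] unfolding closed_substructure_def
    by (intro topspace_subtopology_subset) simp
  have cc: "continuous_map (subtopology ?PM ?X) ?PN (?c \<omega>)" if "\<omega> \<in> \<Omega>" for \<omega>
  proof -
    have "continuous_map (subtopology ?PM ?X) (tplgy Nt) (\<lambda>x. ?c \<omega> x a)" if a: "a \<in> carrier A" for a
    proof -
      have "continuous_map (subtopology ?PM ?X) (tplgy Nt) (\<omega> \<circ> (\<lambda>x. x a))"
        using a cont[OF \<open>\<omega> \<in> \<Omega>\<close>]
        by (intro continuous_map_compose[OF continuous_map_from_subtopology[OF continuous_map_product_projection]]) auto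
      then show ?thesis using a by (simp add: compose_def comp_def)
    qed
    then show ?thesis unfolding continuous_map_componentwise by (auto simp: compose_def)
  qed
  \<comment> \<open>Composition with \<open>\<omega>\<close> is continuous from a compact space to a
    Hausdorff space, hence closed. With \<open>\<Omega>\<close> finite this gives both the
    closedness of \<open>E\<close> and the continuity of \<open>\<gamma>\<close>.\<close>
  have closed_image: "closedin ?PN (?c \<omega> ` K)" if "\<omega> \<in> \<Omega>" "closedin (subtopology ?PM ?X) K" for \<omega> K
    using compactin_imp_closedin[OF hP image_compactin[OF closedin_compact_space[OF cX that(2)] cc[OF that(1)]]] .
  have Ecl: "closedin ?PN E"
    unfolding E_def using fin closed_image closedin_topspace[of "subtopology ?PM ?X"] topX
    by (intro closedin_Union) auto
  have Esub: "subuniverse (spower Nt (carrier A)) E"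
    unfolding subuniverse_def
  proof (intro conjI ballI)
    show "E \<subseteq> carrier (spower Nt (carrier A))" using ED DP by simp
    fix g zs assume "g \<in> ops (spower Nt (carrier A))" "zs \<in> tuples E (oar (spower Nt (carrier A)) g)"
    then show "opn (spower Nt (carrier A)) g zs \<in> E"
      using op[of g zs] EI unfolding E_def[symmetric] by (metis spower_simps(1))
  qed
  have Ecs: "closed_substructure (tpower Nt (carrier A)) E"
    using Ecl Esub by (simp add: closed_substructure_def subuniverse_tpower)
  let ?Et = "tinduced (tpower Nt (carrier A)) E" and ?Dt = "tinduced (tpower Nt (carrier A)) (homs Ab N)"
  have "\<gamma> \<in> homs ?Et Nt"
  proof (rule homsI)
    show "\<gamma> z \<in> carrier Nt" if "z \<in> carrier ?Et" for z
      using that wp[of z] \<alpha>X[of "p z"] cont[of "w z"] tM(1) tN(1)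
      by (auto simp: \<gamma>_def continuous_map_def Pi_iff)
  next
    fix g zs assume "g \<in> ops ?Et" "zs \<in> tuples (carrier ?Et) (oar ?Et g)"
    then have g: "g \<in> ops Nt" and zs: "zs \<in> tuples E (oar Nt g)" by simp_all
    obtain \<omega> xs x where \<omega>: "\<omega> \<in> \<Omega>" and xs: "xs \<in> tuples ?X (oar Nt g)" and x: "x \<in> ?X"
      and eq: "zs = map (?c \<omega>) xs" "opn (spower Nt (carrier A)) g zs = ?c \<omega> x"
        "\<omega> (\<alpha> x) = opn Nt g (map \<omega> (map \<alpha> xs))"
      using op[OF g zs[unfolded E_def]] by blast
    have "map \<gamma> zs = map \<omega> (map \<alpha> xs)"
      unfolding eq(1) using xs \<gamma>[OF \<omega>] by (auto simp: tuples_def)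
    then show "\<gamma> (opn ?Et g zs) = opn Nt g (map \<gamma> zs)"
      using eq(2,3) \<gamma>[OF \<omega> x] by (simp del: spower_simps map_map)
  next
    fix r zs assume r: "r \<in> rels ?Et" and zs: "zs \<in> tuples (carrier ?Et) (rar ?Et r)" "zs \<in> rln ?Et r"
    have r': "r \<in> rels Nt" and zE: "set zs \<subseteq> E" and len: "length zs = rar Nt r"
      using r zs by (simp_all add: tuples_def)
    have R: "map (\<lambda>z. z a) zs \<in> rln Nt r" if "a \<in> carrier A" for a using zs that by simp
    have m2: "map2 (\<lambda>\<omega> x. \<omega> x) (map w zs) (map f (map p zs)) = map (\<lambda>z. w z (f (p z))) zs" for f :: "_ \<Rightarrow> 'm"
      by (simp add: zip_map1 zip_map2 zip_same_conv_map comp_def)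
    \<comment> \<open>The entries of \<open>zs\<close> may come from different members of
      \<open>\<Omega>\<close>; this is why \<open>max_rels\<close> allows a separate map in each
      coordinate.\<close>
    have "map2 (\<lambda>\<omega> x. \<omega> x) (map w zs) (map \<alpha> (map p zs)) \<in> rln Nt r"
    proof (rule entailed_max_rels_preserved[OF rel[OF r'] A \<alpha>])
      show "map p zs \<in> tuples ?X (rar Nt r)" using wp(2) zE len by (auto simp: tuples_def)
      show "length (map w zs) = rar Nt r" "set (map w zs) \<subseteq> \<Omega>" using wp(1) zE len by auto
      fix a assume a: "a \<in> carrier A"
      have "w z (p z a) = z a" if "z \<in> set zs" for z
        using fun_cong[OF wp(3)[of z], of a] that zE a by (auto simp: compose_def)
      then have eq: "map (\<lambda>z. w z (p z a)) zs = map (\<lambda>z. z a) zs" by simp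
      show "map2 (\<lambda>\<omega> x. \<omega> x) (map w zs) (map (\<lambda>x. x a) (map p zs)) \<in> rln Nt r"
        unfolding m2 eq by (rule R[OF a])
    qed
    moreover have "map \<gamma> zs = map (\<lambda>z. w z (\<alpha> (p z))) zs" using zE by (auto simp: \<gamma>_def)
    ultimately show "map \<gamma> zs \<in> rln Nt r" unfolding m2 by (simp only:)
  qed (simp_all add: \<gamma>_def)
  moreover have "continuous_map (tplgy ?Et) (tplgy Nt) \<gamma>"
    unfolding continuous_map_closedin
  proof (intro conjI ballI allI impI)
    have topE: "topspace (tplgy ?Et) = E"
      using closedin_subset[OF Ecl] by auto
    show "\<gamma> \<in> topspace (tplgy ?Et) \<rightarrow> topspace (tplgy Nt)"
      using \<open>\<gamma> \<in> homs ?Et Nt\<close> homsD(3)[of \<gamma> ?Et Nt] topE tN(1) by auto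
    fix C assume C: "closedin (tplgy Nt) C"
    \<comment> \<open>Since \<open>\<gamma>\<close> after composition with \<open>\<omega>\<close>
      is \<open>\<omega> \<circ> \<alpha>\<close>, the preimage of \<open>C\<close> under
      \<open>\<gamma>\<close> is the finite union of the images of these closed sets.\<close>
    let ?K = "\<lambda>\<omega>. {x \<in> ?X. (\<omega> \<circ> \<alpha>) x \<in> C}"
    have "closedin (subtopology ?PM ?X) (?K \<omega>)" if "\<omega> \<in> \<Omega>" for \<omega>
      using closedin_continuous_map_preimage[OF continuous_map_compose[OF \<alpha>c cont[OF that]] C]
      unfolding topX .
    then have "closedin ?PN (\<Union>\<omega>\<in>\<Omega>. ?c \<omega> ` ?K \<omega>)"
      using fin closed_image by (intro closedin_Union) auto
    moreover have "(\<Union>\<omega>\<in>\<Omega>. ?c \<omega> ` ?K \<omega>) = {z \<in> topspace (tplgy ?Et). \<gamma> z \<in> C}"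
    proof (intro equalityI subsetI)
      fix z assume "z \<in> (\<Union>\<omega>\<in>\<Omega>. ?c \<omega> ` ?K \<omega>)"
      then show "z \<in> {z \<in> topspace (tplgy ?Et). \<gamma> z \<in> C}" using \<gamma> EI topE by auto
    next
      fix z assume "z \<in> {z \<in> topspace (tplgy ?Et). \<gamma> z \<in> C}"
      then have z: "z \<in> E" "\<gamma> z \<in> C" using topE by auto
      then have "p z \<in> ?K (w z)" using wp(2) by (simp add: \<gamma>_def)
      then show "z \<in> (\<Union>\<omega>\<in>\<Omega>. ?c \<omega> ` ?K \<omega>)" using wp(1,3)[OF z(1)] by blast
    qed
    ultimately have "closedin ?PN {z \<in> topspace (tplgy ?Et). \<gamma> z \<in> C}" by simp
    then show "closedin (tplgy ?Et) {z \<in> topspace (tplgy ?Et). \<gamma> z \<in> C}"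
      using topE by (auto simp: closedin_subtopology)
  qed
  ultimately have \<gamma>t: "\<gamma> \<in> thoms ?Et Nt" by (simp add: thoms_def)
  \<comment> \<open>The carrier of \<open>A\<close> is the required non-empty index set. Both
    structures have carriers over \<open>'c \<Rightarrow> 'n\<close>, the type at which injectivity
    is assumed.\<close>
  have "in_IScP Nt ?Et" "in_IScP Nt ?Dt"
    using in_IScP_substructure[OF N(2) A'(2)] Ecs D by auto
  with \<gamma>t is_tembedding_subset[OF D Ecs ED] inj
  have "\<exists>\<beta>\<in>thoms ?Dt Nt. \<forall>z\<in>carrier ?Et. \<beta> z = \<gamma> z"
    unfolding injective_in_IScP_def by blast
  then obtain \<beta> where \<beta>: "\<beta> \<in> thoms ?Dt Nt" "\<And>z. z \<in> E \<Longrightarrow> \<beta> z = \<gamma> z" by auto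
  show ?thesis
  proof (intro bexI ballI)
    show "\<beta> \<in> thoms (dualD N Nt Ab) Nt" using \<beta>(1) Ab(2) by (simp add: dualD_def)
    show "\<beta> (?c \<omega> x) = \<omega> (\<alpha> x)" if "\<omega> \<in> \<Omega>" "x \<in> ?X" for \<omega> x
      using \<beta>(2)[OF EI[OF that]] \<gamma>[OF that] by simp
  qed
qed

text \<open>Over a singleton the only list of length two is \<open>[\<omega>, \<omega>]\<close>,
  whose preimage of the diagonal is the kernel. So the kernel condition for a single map is a case
  of the diagonal condition for \<open>\<Omega>\<close>.\<close>

lemma max_rels_singleton_diagonal:
  assumes "s \<in> max_rels M {\<omega>} 2 (diagonal D)"
  shows "maximal_substructure M 2 (ker_rel (carrier M) D \<omega>) s"
proof -
  obtain \<omega>s where \<omega>s: "length \<omega>s = 2" "set \<omega>s \<subseteq> {\<omega>}"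
    and max: "maximal_substructure M 2 (preimage_rel (carrier M) \<omega>s (diagonal D)) s"
    using assms by (auto simp: max_rels_def)
  have "\<omega>s = [\<omega>, \<omega>]" using \<omega>s by (cases \<omega>s; cases "tl \<omega>s") auto
  with max show ?thesis by (simp add: ker_rel_def)
qed

text \<open>Equality of the composites says that the pair \<open>[x, y]\<close> lies pointwise in
  the preimage of the diagonal under \<open>[\<omega>, \<omega>']\<close>. The values must lie in
  \<open>D\<close>, as \<open>diagonal D\<close> has no other pairs.\<close>

lemma compose_eq_diagonal_entailed:
  fixes A :: "('a, 'f, 'r) fo_struct"
  assumes ent: "\<forall>s\<in>max_rels M \<Omega> 2 (diagonal D). entails TYPE('a) M Mt 2 s"
    and A: "in_ISP M A" and \<alpha>: "\<alpha> \<in> thoms (dualD M Mt A) Mt"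
    and \<omega>: "\<omega> \<in> \<Omega>" "\<omega>' \<in> \<Omega>" "\<omega> ` carrier M \<subseteq> D"
    and x: "x \<in> homs A M" "y \<in> homs A M"
    and eq: "compose (carrier A) \<omega> x = compose (carrier A) \<omega>' y"
  shows "\<omega> (\<alpha> x) = \<omega>' (\<alpha> y)"
proof -
  have "map2 (\<lambda>\<omega> x. \<omega> x) [\<omega>, \<omega>'] (map \<alpha> [x, y]) \<in> diagonal D"
  proof (rule entailed_max_rels_preserved[OF ent A \<alpha>])
    show "[x, y] \<in> tuples (homs A M) 2" using x by (simp add: tuples_def)
    fix a assume a: "a \<in> carrier A"
    then have "\<omega> (x a) = \<omega>' (y a)" using fun_cong[OF eq, of a] by (simp add: compose_def)
    moreover have "\<omega> (x a) \<in> D" using homsD(3)[OF x(1) a] \<omega>(3) by auto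
    ultimately show "map2 (\<lambda>\<omega> x. \<omega> x) [\<omega>, \<omega>'] (map (\<lambda>x. x a) [x, y]) \<in> diagonal D"
      by (simp add: diagonal_def)
  qed (use \<omega> in simp_all)
  then show ?thesis by (simp add: diagonal_def)
qed

text \<open>Evaluating the equal composites at the term value \<open>t(a)\<close> instead of
  \<open>a\<close> gives \<open>\<omega>(t(x a)) = \<omega>(t(y a))\<close>, because homomorphisms
  commute with \<open>t\<close>. Letting \<open>t\<close> vary separates \<open>x a\<close> from
  \<open>y a\<close> unless they agree.\<close>

lemma compose_inj_on_homs:
  assumes sep: "separates_points (comp_sets {\<omega>} (Clo1 M)) (carrier M)"
    and A: "is_struct A" "sig A = sig M" and x: "x \<in> homs A M" "y \<in> homs A M"
    and eq: "compose (carrier A) \<omega> x = compose (carrier A) \<omega> y"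
  shows "x = y"
proof (rule extensionalityI)
  show "x \<in> extensional (carrier A)" "y \<in> extensional (carrier A)"
    using homsD(1) x by blast+
  fix a assume a: "a \<in> carrier A"
  show "x a = y a"
  proof (rule ccontr)
    assume "x a \<noteq> y a"
    moreover have xy: "x a \<in> carrier M" "y a \<in> carrier M" using homsD(3)[OF _ a] x by auto
    ultimately obtain z where z: "z \<in> comp_sets {\<omega>} (Clo1 M)" "z (x a) \<noteq> z (y a)"
      using sep by (auto simp: separates_points_def)
    obtain t where t: "wf_trm (sig M) 1 t" "z = \<omega> \<circ> (\<lambda>x\<in>carrier M. trm_val M [x] t)"
      using z(1) by (auto simp: comp_sets_def Clo1_def)
    have as: "[a] \<in> tuples (carrier A) 1" using a by (simp add: tuples_def)
    have ta: "trm_val A [a] t \<in> carrier A"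
      using trm_val_closed[OF A(1) _ as] t(1) A(2) by simp
    have "x (trm_val A [a] t) = trm_val M [x a] t" "y (trm_val A [a] t) = trm_val M [y a] t"
      using hom_trm_val[OF A(1) _ _ as] x t(1) A(2) by (auto simp: homs_def)
    then have "\<omega> (trm_val M [x a] t) = \<omega> (trm_val M [y a] t)"
      using fun_cong[OF eq, of "trm_val A [a] t"] ta by (simp add: compose_def)
    then show False using z(2) t(2) xy by simp
  qed
qed

text \<open>A tuple of composites may mix several members of \<open>\<Omega>\<close>, while the
  action of an operation is controlled for one at a time. Mixing is excluded by a single map or by
  arity at most one; the empty tuple still needs some \<open>\<omega>\<close>, whence
  \<open>\<Omega> \<noteq> {}\<close>.\<close>

lemma tuples_UN_lift:
  assumes "zs \<in> tuples (\<Union>\<omega>\<in>\<Omega>. f \<omega> ` X) n" "\<Omega> \<noteq> {}" "(\<exists>\<omega>. \<Omega> = {\<omega>}) \<or> n \<le> 1"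
  shows "\<exists>\<omega>\<in>\<Omega>. \<exists>xs\<in>tuples X n. zs = map (f \<omega>) xs"
proof (cases "\<exists>\<omega>. \<Omega> = {\<omega>}")
  case True
  then obtain \<omega> where "\<Omega> = {\<omega>}" "zs \<in> tuples (f \<omega> ` X) n" using assms(1) by auto
  then show ?thesis by (auto elim!: tuples_lift)
next
  case False
  then have "n \<le> 1" using assms(3) by blast
  then consider "n = 0" | "n = 1" by linarith
  then show ?thesis
  proof cases
    case 1
    then show ?thesis using assms(1,2) by (auto simp: tuples_def)
  next
    case 2
    then obtain z where zs: "zs = [z]" "z \<in> (\<Union>\<omega>\<in>\<Omega>. f \<omega> ` X)"
      using assms(1) by (auto simp: tuples_def length_Suc_conv)
    then obtain \<omega> x where "\<omega> \<in> \<Omega>" "x \<in> X" "z = f \<omega> x" by blast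
    with 2 zs(1) show ?thesis
      by (intro bexI[of _ \<omega>] bexI[of _ "[x]"]) (simp_all add: tuples_def)
  qed
qed

section \<open>Dualisation from either alternative\<close>

theorem theorem3p3:
  fixes M :: "('m, 'f1, 'r1) fo_struct"
    and Mt :: "('m, 'f2, 'r2) fo_tstruct"
    and N :: "('n, 'f3, 'r3) fo_struct"
    and Nt :: "('n, 'f4, 'r4) fo_tstruct"
    and Mb :: "('m, 'f3, 'r3) fo_struct"
    and \<Omega> :: "('m \<Rightarrow> 'n) set"
  assumes M: "total_structure M" "nontrivial M"
    and N: "total_structure N" "nontrivial N"
    and Mt: "total_tstructure Mt" "alter_ego M Mt"
    and Nt: "total_tstructure Nt" "alter_ego N Nt"
    and full: "fully_dualises TYPE('c) TYPE('c \<Rightarrow> 'n) N Nt"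
    and inj_Nt: "injective_in_IScP TYPE('c \<Rightarrow> 'n) Nt"
    and inj_N: "injective_in_ISP TYPE('c) N"
    and Mb: "structural_reduct Mb M" "in_ISP N Mb"
    and \<Omega>: "\<Omega> \<subseteq> homs Mb N"
    and alternatives:
      "(\<exists>\<omega>. \<Omega> = {\<omega>} \<and>
          continuous_map (tplgy Mt) (tplgy Nt) \<omega> \<and>
          separates_structure (comp_sets {\<omega>} (Clo1 Mt)) Mb N \<and>
          (purely_relational Nt \<or>
           (\<exists>Mtb :: ('m, 'f4, 'r4) fo_tstruct.
              structural_reduct Mtb Mt \<and> tplgy Mtb = tplgy Mt \<and> in_IScP Nt Mtb \<and>
              \<omega> \<in> thoms Mtb Nt)) \<and>
          (\<forall>r\<in>rels Nt. \<forall>s\<in>max_rels M {\<omega>} (rar Nt r) (rln Nt r).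
             entails TYPE('c) M Mt (rar Nt r) s) \<and>
          ((\<forall>s. maximal_substructure M 2 (ker_rel (carrier M) (carrier N) \<omega>) s \<longrightarrow>
                entails TYPE('c) M Mt 2 s) \<or>
           separates_points (comp_sets {\<omega>} (Clo1 M)) (carrier M)))
       \<or>
       (finite \<Omega> \<and>
        (\<forall>\<omega>\<in>\<Omega>. continuous_map (tplgy Mt) (tplgy Nt) \<omega>) \<and>
        separates_structure (comp_sets \<Omega> (Clo1 Mt)) Mb N \<and>
        (purely_relational Nt \<or>
         (\<exists>Mtb :: ('m, 'f4, 'r4) fo_tstruct.
            structural_reduct Mtb Mt \<and> tplgy Mtb = tplgy Mt \<and> in_IScP Nt Mtb \<and>
            (\<forall>\<omega>\<in>\<Omega>. \<omega> \<in> thoms Mtb Nt)) \<and>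
         (\<forall>g\<in>ops Nt. oar Nt g \<le> 1)) \<and>
        (\<forall>r\<in>rels Nt. \<forall>s\<in>max_rels M \<Omega> (rar Nt r) (rln Nt r).
           entails TYPE('c) M Mt (rar Nt r) s) \<and>
        (\<forall>s\<in>max_rels M \<Omega> 2 (diagonal (carrier N)).
           entails TYPE('c) M Mt 2 s))"
  shows "dualises TYPE('c) M Mt"
proof (rule dualises_I[OF Mt M(1)])
  fix A :: "('c, 'f1, 'r1) fo_struct" and \<alpha>
  assume A: "in_ISP M A" and \<alpha>: "\<alpha> \<in> thoms (dualD M Mt A) Mt"
  note A' = in_ISP_D[OF A]
  have cM: "carrier Mb = carrier M" "carrier Mt = carrier M"
    using Mb(1) alter_ego_D(1)[OF Mt(2)] by (simp_all add: structural_reduct_def)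
  have fin: "finite \<Omega>" using alternatives by auto
  have cont: "continuous_map (tplgy Mt) (tplgy Nt) \<omega>" if "\<omega> \<in> \<Omega>" for \<omega>
    using alternatives that by auto
  have sep: "separates_points (comp_sets \<Omega> (Clo1 Mt)) (carrier M)"
    using alternatives unfolding separates_structure_def cM by blast
  \<comment> \<open>An empty family could not separate two distinct points of
    \<open>M\<close>.\<close>
  have ne: "\<Omega> \<noteq> {}"
    using sep M(2) by (auto simp: separates_points_def comp_sets_def nontrivial_def)
  have rel: "\<forall>s\<in>max_rels M \<Omega> (rar Nt r) (rln Nt r). entails TYPE('c) M Mt (rar Nt r) s"
    if "r \<in> rels Nt" for r
    using alternatives that by blast
  have ops: "ops Nt = {} \<or> (\<exists>Mtb :: ('m, 'f4, 'r4) fo_tstruct. structural_reduct Mtb Mt \<and>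
      (\<forall>\<omega>\<in>\<Omega>. \<omega> \<in> homs Mtb Nt) \<and> ((\<exists>\<omega>. \<Omega> = {\<omega>}) \<or> (\<forall>g\<in>ops Nt. oar Nt g \<le> 1)))"
    using alternatives unfolding purely_relational_def thoms_def by blast
  have \<omega>M: "\<omega> ` carrier M \<subseteq> carrier N" if "\<omega> \<in> \<Omega>" for \<omega>
    using \<Omega> that homsD(3)[of \<omega> Mb N] cM(1) by auto
  have wd: "\<omega> (\<alpha> x) = \<omega>' (\<alpha> y)"
    if \<omega>: "\<omega> \<in> \<Omega>" "\<omega>' \<in> \<Omega>" and x: "x \<in> homs A M" "y \<in> homs A M"
      and eq: "compose (carrier A) \<omega> x = compose (carrier A) \<omega>' y" for \<omega> \<omega>' x y
  \<comment> \<open>If this fails, \<open>\<Omega>\<close> is a singleton, and the kernel condition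
    is ruled out because it would imply the one that fails. Then separation by term functions of
    \<open>M\<close> remains, and it forces \<open>x = y\<close>.\<close>
  proof (cases "\<forall>s\<in>max_rels M \<Omega> 2 (diagonal (carrier N)). entails TYPE('c) M Mt 2 s")
    case True
    then show ?thesis by (rule compose_eq_diagonal_entailed[OF _ A \<alpha> \<omega> \<omega>M[OF \<omega>(1)] x eq])
  next
    case False
    then obtain \<omega>0 where \<omega>0: "\<Omega> = {\<omega>0}"
      and "(\<forall>s. maximal_substructure M 2 (ker_rel (carrier M) (carrier N) \<omega>0) s \<longrightarrow>
              entails TYPE('c) M Mt 2 s) \<or>
           separates_points (comp_sets {\<omega>0} (Clo1 M)) (carrier M)"
      using alternatives by auto
    with False have "separates_points (comp_sets {\<omega>} (Clo1 M)) (carrier M)"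
      using max_rels_singleton_diagonal \<omega>(1) by blast
    moreover have "\<omega>' = \<omega>" using \<omega> \<omega>0 by simp
    ultimately show ?thesis
      using compose_inj_on_homs[OF _ A'(1,3) x] eq by blast
  qed
  have X: "closed_substructure (tpower Mt (carrier A)) (homs A M)"
    using closed_substructure_homs[OF Mt M(1) A'(1,3)] .
  have op: "\<exists>\<omega>\<in>\<Omega>. \<exists>xs\<in>tuples (homs A M) (oar Nt g). \<exists>x\<in>homs A M.
        zs = map (compose (carrier A) \<omega>) xs \<and>
        opn (spower Nt (carrier A)) g zs = compose (carrier A) \<omega> x \<and>
        \<omega> (\<alpha> x) = opn Nt g (map \<omega> (map \<alpha> xs))"
    if g: "g \<in> ops Nt" and zs: "zs \<in> tuples (\<Union>\<omega>\<in>\<Omega>. compose (carrier A) \<omega> ` homs A M) (oar Nt g)"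
    for g zs
  proof -
    \<comment> \<open>The operation \<open>g\<close> shows that \<open>Nt\<close> is not purely
      relational, so the reduct of \<open>Mt\<close> is available.\<close>
    obtain Mtb :: "('m, 'f4, 'r4) fo_tstruct" where Mtb: "structural_reduct Mtb Mt"
      "\<And>\<omega>. \<omega> \<in> \<Omega> \<Longrightarrow> \<omega> \<in> homs Mtb Nt" "(\<exists>\<omega>. \<Omega> = {\<omega>}) \<or> oar Nt g \<le> 1"
      using ops g by auto
    obtain \<omega> xs where \<omega>: "\<omega> \<in> \<Omega>" and xs: "xs \<in> tuples (homs A M) (oar Nt g)"
      and eq: "zs = map (compose (carrier A) \<omega>) xs"
      using tuples_UN_lift[OF zs ne Mtb(3)] by blast
    show ?thesis
      using reduct_opn_compose[OF X \<alpha> Mtb(1) Mtb(2)[OF \<omega>] g xs] \<omega> xs eq by blast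
  qed
  obtain Ab :: "('c, 'f3, 'r3) fo_struct" where Ab: "in_ISP N Ab" "carrier Ab = carrier A"
    and hb: "\<And>x. x \<in> homs A M \<Longrightarrow> x \<in> homs Ab Mb"
    using structural_reduct_of_member[OF Mb A] by blast
  have comp: "compose (carrier A) \<omega> x \<in> homs Ab N" if "\<omega> \<in> \<Omega>" "x \<in> homs A M" for \<omega> x
    using homs_compose[OF _ hb[OF that(2)] in_ISP_D(1)[OF Ab(1)]] \<Omega> that(1) Ab(2) by auto
  have "\<exists>\<beta>\<in>thoms (dualD N Nt Ab) Nt. \<forall>\<omega>\<in>\<Omega>. \<forall>x\<in>homs A M.
      \<beta> (compose (carrier A) \<omega> x) = \<omega> (\<alpha> x)"
    by (rule piggyback_extension[OF M(1) Mt N(1) Nt inj_Nt A Ab]) (fact comp \<alpha> fin cont wd rel op)+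
  then obtain \<beta> where \<beta>: "\<beta> \<in> thoms (dualD N Nt Ab) Nt"
    "\<And>\<omega> x. \<omega> \<in> \<Omega> \<Longrightarrow> x \<in> homs A M \<Longrightarrow> \<beta> (compose (carrier A) \<omega> x) = \<omega> (\<alpha> x)"
    by blast
  have "dualises TYPE('c) N Nt" using full by (simp add: fully_dualises_def)
  \<comment> \<open>As one \<open>\<beta>\<close> extends the values for all composites, one point
    \<open>a\<close> serves every \<open>\<omega>\<close> and every \<open>x\<close>.\<close>
  then obtain a where a: "a \<in> carrier A" "\<And>z. z \<in> homs Ab N \<Longrightarrow> \<beta> z = z a"
    using dualises_D[OF _ Ab(1) \<beta>(1)] Ab(2) by metis
  have \<omega>a: "\<omega> (\<alpha> x) = \<omega> (x a)" if "\<omega> \<in> \<Omega>" "x \<in> homs A M" for \<omega> x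
    using \<beta>(2)[OF that] a(2)[OF comp[OF that]] a(1) by (simp add: compose_def)
  have "\<alpha> x = x a" if x: "x \<in> homs A M" for x
  proof (rule ccontr)
    assume "\<alpha> x \<noteq> x a"
    moreover have c: "\<alpha> x \<in> carrier M" "x a \<in> carrier M"
      using \<alpha> x a(1) homsD(3)[OF x] cM(2) by (auto simp: thoms_def homs_def is_hom_def dualD_def)
    ultimately obtain z where z: "z \<in> comp_sets \<Omega> (Clo1 Mt)" "z (\<alpha> x) \<noteq> z (x a)"
      using sep by (auto simp: separates_points_def)
    obtain \<omega> t where \<omega>: "\<omega> \<in> \<Omega>" and t: "wf_trm (sig Mt) 1 t"
      and zt: "z = \<omega> \<circ> (\<lambda>x\<in>carrier Mt. trm_val Mt [x] t)"
      using z(1) by (auto simp: comp_sets_def Clo1_def)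
    \<comment> \<open>Let \<open>y\<close> be the result of applying \<open>t\<close> to
      \<open>x\<close> in the dual. Then \<open>\<omega>(t(\<alpha> x)) = \<omega>(\<alpha> y) =
      \<omega>(y a) = \<omega>(t(x a))\<close>, contrary to the choice of \<open>z\<close>.\<close>
    have "[x] \<in> tuples (homs A M) 1" using x by (simp add: tuples_def)
    then obtain y where y: "y \<in> homs A M" "y a = trm_val Mt [x a] t" "\<alpha> y = trm_val Mt [\<alpha> x] t"
      using dual_term[OF X \<alpha> t] a(1) by fastforce
    then show False using \<omega>a[OF \<omega> y(1)] z(2) zt c cM(2) by simp
  qed
  with a(1) show "\<exists>a\<in>carrier A. \<forall>x\<in>homs A M. \<alpha> x = x a" by blast
qed

end
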